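(* Let $A$ be a complex unital Banach algebra and let $e,f\in A$ be two invertible and positive elements. Suppose in addition that $a\in A$ is such that $a^\dag_{e,f}$ and $a^{\sharp}$ exist. Let $k,l\ge 1$ be integers and $\lambda\in\mathbb C\setminus\{0\}$. Then the following statements are equivalent: (i) $a$ is weighted EP with weights $e$ and $f$; (ii) $a^{\dag}_{e,f}A=aA$ and $(a^{\dag}_{e,f})^{-1}(0)=a^{-1}(0)$; (iii) $a^\dag_{e,f}A\subseteq aA$ and $a^{-1}(0)\subseteq (a^\dag_{e,f})^{-1}(0)$; (iv) $aA\subseteq a^\dag_{e,f}A$ and $a^{-1}(0)\subseteq (a^\dag_{e,f})^{-1}(0)$; (v) $a^\dag_{e,f}A\subseteq aA$ and $(a^\dag_{e,f})^{-1}(0)\subseteq a^{-1}(0)$; (vi) $aA\subseteq a^\dag_{e,f}A$ and $(a^\dag_{e,f})^{-1}(0)\subseteq a^{-1}(0)$; (vii) $a^\dag_{e,f}=a(a^\dag_{e,f})^2=(a^\dag_{e,f})^2a$; (viii) $a^\dag_{e,f}$ is weighted EP with weights $f$ and $e$; (ix) $a^{\dag}_{e,f}a^{\sharp}a+aa^{\sharp}a^{\dag}_{e,f}=2a^{\dag}_{e,f}$; (x) $(a^{\dag}_{e,f})^2a^{\sharp}=a^{\dag}_{e,f}a^{\sharp}a^{\dag}_{e,f}=a^{\sharp}(a^{\dag}_{e,f})^2$; (xi) $a(a^{\dag}_{e,f})^2=a^{\sharp}=(a^{\dag}_{e,f})^2a$; (xii) $aa^{\dag}_{e,f}a^{\dag}_{e,f}a=a^{\dag}_{e,f}aaa^{\dag}_{e,f}$;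 (xiii) $aa^{\sharp}a^{\dag}_{e,f}=a^{\dag}_{e,f}a^{\sharp}a$; (xiv) $a\in a^{\dag}_{e,f}A^{-1}\cap A^{-1}a^{\dag}_{e,f}$; (xv) there exist $u,v\in A$ such that $a=a^{\dag}_{e,f}u=va^{\dag}_{e,f}$, $uA=A$ and $v^{-1}(0)=\{0\}$; (xvi) $a\in a^{\dag}_{e,f}A\cap Aa^{\dag}_{e,f}$; (xvii) if $b\in A$ is such that $ab=ba$, then $a^{\dag}_{e,f}b=ba^{\dag}_{e,f}$; (xviii) there exists a holomorphic function $h\colon U\to \mathbb C$, with $U\subseteq\mathbb C$ open and $\sigma(a)\subseteq U$, such that $a^{\dag}_{e,f}=h(a)$ (holomorphic functional calculus); (xix) $(a^{\sharp})^ka^{\dag}_{e,f}a=(a^{\dag}_{e,f})^k$; (xx) $a^k=a^{\dag}_{e,f}aa^k=a^kaa^{\dag}_{e,f}$; (xxi) $(a^{\dag}_{e,f})^k=(a^{\sharp})^k$; (xxii) $(a^{\sharp})^k a^{\dag}_{e,f}=a^{\dag}_{e,f}(a^{\sharp})^k$; (xxiii) $a^k a^{\dag}_{e,f}=a^{\dag}_{e,f}a^k$; (xxiv) $a^{2k-1}= a^{\dag}_{e,f} a^{2k+1}a^{\dag}_{e,f}$; (xxv) $a(a^{\dag}_{e,f})^{k+1}=(a^{\sharp})^k=(a^{\dag}_{e,f})^{k+1}a$; (xxvi) $a^kaa^{\dag}_{e,f}+a^{\dag}_{e,f}aa^k=2a^k$; (xxvii) $(a^{\sharp})^{k+l-1}=(a^{\dag}_{e,f})^l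 (a^{\sharp})^{k-1}= (a^{\sharp})^{k-1}(a^{\dag}_{e,f})^l$; (xxviii) $aa^{\dag}_{e,f}(a^{\sharp})^{k+l-1}=(a^{\dag}_{e,f})^k(a^{\sharp})^la=(a^{\sharp})^la(a^{\dag}_{e,f})^k$; (xxix) $a$ is weighted EP with weights $f$ and $e$; (xxx) $a$ is both weighted EP with weights $e$ and $e$ and weighted EP with weights $f$ and $f$; (xxxi) $a^k$ is weighted EP with weights $e$ and $f$; (xxxii) $a^{\sharp}$ is weighted EP with weights $e$ and $f$; (xxxiii) $aa^{\sharp}=aa^\dagger_{e,e}=aa^\dagger_{f,f}$ (or, alternatively, $aa^{\sharp}=a^\dagger_{e,e}a=a^\dagger_{f,f}a$); (xxxiv) $aa^{\sharp}=aa^\dagger_{e,f}=aa^\dagger_{f,e}$ (or, alternatively, $aa^{\sharp}=a^\dagger_{f,e}a=a^\dagger_{e,f}a$); (xxxv) $aa^\dagger_{e,f}(a^k+\lambda a^\dagger_{e,f})=(a^k+\lambda a^\dagger_{e,f})aa^\dagger_{e,f}$; (xxxvi) $a^\dagger_{e,f}a(a^k+\lambda a^\dagger_{e,f})=(a^k+\lambda a^\dagger_{e,f})a^\dagger_{e,f}a$; (xxxvii) $(a+\lambda a^\dagger_{e,e})A=(a+\lambda a^\dagger_{f,f})A=(\lambda a+a^3)A$ and $(a+\lambda a^\dagger_{e,e})^{-1}(0)=(a+\lambda a^\dagger_{f,f})^{-1}(0)=(\lambda a+a^3)^{-1}(0)$; (xxxviii) $(a+\lambda a^\dagger_{e,f})A=(\lambda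 a+a^3)A$ and $(a+\lambda a^\dagger_{e,f})^{-1}(0)=(\lambda a+a^3)^{-1}(0)$.
   Context: Let $A$ be a complex unital Banach algebra; $A^{-1}$ is the set of its invertible elements. For $x\in A$, $xA=\{xy:y\in A\}$, $Ax=\{yx:y\in A\}$, and $x^{-1}(0)=\{y\in A: xy=0\}$ (the null space of left multiplication by $x$); $x^0=1$. An element $h\in A$ is hermitian if $\|\exp(ith)\|=1$ for all $t\in\mathbb R$ (for $t=0$ this entails $\|1\|=1$); $H(A)$ is the set of hermitian elements of $A$. An element $c\in A$ is positive if $V(c)=\{\varphi(c):\varphi\in A^*,\ \|\varphi\|\le 1,\ \varphi(1)=1\}\subset[0,\infty)$; equivalently, $c$ is hermitian and $\sigma(c)\subset[0,\infty)$. A positive element $c$ has a unique positive square root, denoted $c^{1/2}$. For $u\in A$ invertible and positive, $u^{-1/2}=(u^{1/2})^{-1}$, and $A^u$ denotes the Banach algebra $A$ endowed with the norm $\|x\|_u=\|u^{1/2}xu^{-1/2}\|$. An element $b\in A$ is a normalized generalized inverse of $a\in A$ if $aba=a$ and $bab=b$. Given $e,f\in A$ invertible and positive, $a$ is weighted Moore-Penrose invertible with weights $e$ and $f$ if there is a normalized generalized inverse $b$ of $a$ with $ab\in H(A^e)$ and $ba\in H(A^f)$; such $b$ is unique when it exists and is denoted $a^{\dag}_{e,f}$ (also written $a^{\dagger}_{e,f}$). The element $a$ is weighted EP with weights $e$ and $f$ if $a^{\dag}_{e,f}$ exists and commutes with $a$. The group inverse of $a$, denoted $a^{\sharp}$,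 is the (unique, when it exists) $b\in A$ with $aba=a$, $bab=b$, $ab=ba$. Conventions: a statement involving a weighted Moore-Penrose inverse with a pair of weights other than $(e,f)$ includes the assertion that this inverse exists. In (xxxiii) and (xxxiv), each of the two alternative forms is equivalent to the other statements. *)

theory Defs
  imports "HOL-Complex_Analysis.Complex_Analysis"
begin

section \<open>Complex unital Banach algebras\<close>

class scaleC = scaleR +
  fixes scaleC :: "complex \<Rightarrow> 'a \<Rightarrow> 'a"  (infixr "*\<^sub>C" 75)

text \<open>The normalisation \<open>norm 1 = 1\<close>, inherited from \<^class>\<open>real_normed_algebra_1\<close>, is forced
  by the existence of hermitian elements.\<close>

class complex_banach_algebra_1 = real_normed_algebra_1 + banach + scaleC +
  assumes scaleC_add_right: "z *\<^sub>C (x + y) = z *\<^sub>C x + z *\<^sub>C y"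
    and scaleC_add_left: "(z + w) *\<^sub>C x = z *\<^sub>C x + w *\<^sub>C x"
    and scaleC_scaleC: "z *\<^sub>C w *\<^sub>C x = (z * w) *\<^sub>C x"
    and scaleC_of_real: "complex_of_real r *\<^sub>C x = r *\<^sub>R x"
    and mult_scaleC_left: "(z *\<^sub>C x) * y = z *\<^sub>C (x * y)"
    and mult_scaleC_right: "x * (z *\<^sub>C y) = z *\<^sub>C (x * y)"
    and norm_scaleC: "norm (z *\<^sub>C x) = cmod z * norm x"

instantiation complex :: complex_banach_algebra_1
begin

definition scaleC_complex :: "complex \<Rightarrow> complex \<Rightarrow> complex"
  where "scaleC_complex z x = z * x"

instance
  by standard (simp_all add: scaleC_complex_def algebra_simps norm_mult scaleR_conv_of_real)

end


section \<open>Invertible elements, ideals, null spaces, spectrum\<close>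

definition inv_elems :: "'a::complex_banach_algebra_1 set"
  where "inv_elems = {x. \<exists>y. x * y = 1 \<and> y * x = 1}"

definition alg_inv :: "'a::complex_banach_algebra_1 \<Rightarrow> 'a"
  where "alg_inv x = (THE y. x * y = 1 \<and> y * x = 1)"

text \<open>\<open>xA\<close>, \<open>Ax\<close> and \<open>x\<^sup>-\<^sup>1(0)\<close>.\<close>

definition right_ideal :: "'a::complex_banach_algebra_1 \<Rightarrow> 'a set"
  where "right_ideal x = {x * y | y. True}"

definition left_ideal :: "'a::complex_banach_algebra_1 \<Rightarrow> 'a set"
  where "left_ideal x = {y * x | y. True}"

definition null_space :: "'a::complex_banach_algebra_1 \<Rightarrow> 'a set"
  where "null_space x = {y. x * y = 0}"

definition spectrum :: "'a::complex_banach_algebra_1 \<Rightarrow> complex set"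
  where "spectrum x = {z. z *\<^sub>C 1 - x \<notin> inv_elems}"


section \<open>Holomorphic functional calculus\<close>

text \<open>\<open>cycle_around K U \<Gamma>\<close>: the closed paths in \<open>\<Gamma>\<close> form a cycle in \<open>U - K\<close> which has winding
  number 1 about the points of \<open>K\<close> and 0 about the points outside \<open>U\<close>.\<close>

definition cycle_around :: "complex set \<Rightarrow> complex set \<Rightarrow> (real \<Rightarrow> complex) list \<Rightarrow> bool"
  where "cycle_around K U \<Gamma> \<longleftrightarrow>
    (\<forall>\<gamma>\<in>set \<Gamma>. valid_path \<gamma> \<and> pathfinish \<gamma> = pathstart \<gamma> \<and> path_image \<gamma> \<subseteq> U - K) \<and>
    (\<forall>z\<in>K. (\<Sum>\<gamma>\<leftarrow>\<Gamma>. winding_number \<gamma> z) = 1) \<and>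
    (\<forall>z. z \<notin> U \<longrightarrow> (\<Sum>\<gamma>\<leftarrow>\<Gamma>. winding_number \<gamma> z) = 0)"

text \<open>The library's \<^const>\<open>contour_integral\<close> is only available for complex-valued integrands;
  here the integrand \<open>h(z) (z - x)\<^sup>-\<^sup>1\<close> takes values in the algebra.\<close>

definition resolvent_integral ::
    "(complex \<Rightarrow> complex) \<Rightarrow> 'a::complex_banach_algebra_1 \<Rightarrow> (real \<Rightarrow> complex) \<Rightarrow> 'a"
  where "resolvent_integral h x \<gamma> =
    integral {0..1} (\<lambda>t. (h (\<gamma> t) * vector_derivative \<gamma> (at t within {0..1})) *\<^sub>C
                          alg_inv (\<gamma> t *\<^sub>C 1 - x))"

text \<open>\<open>is_hol_calc U h x y\<close> says \<open>y = h(x)\<close>, for \<open>h\<close> holomorphic on the open set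
  \<open>U \<supseteq> spectrum x\<close>. By Cauchy's theorem the value does not depend on the cycle, and cycles as
  required always exist.\<close>

definition is_hol_calc ::
    "complex set \<Rightarrow> (complex \<Rightarrow> complex) \<Rightarrow> 'a::complex_banach_algebra_1 \<Rightarrow> 'a \<Rightarrow> bool"
  where "is_hol_calc U h x y \<longleftrightarrow>
    (\<exists>\<Gamma>. cycle_around (spectrum x) U \<Gamma> \<and>
         y = (1 / (2 * complex_of_real pi * \<i>)) *\<^sub>C (\<Sum>\<gamma>\<leftarrow>\<Gamma>. resolvent_integral h x \<gamma>))"


section \<open>Positive elements, weighted norms, hermitian elements\<close>

text \<open>Elements of the dual space are the bounded real-linear maps that are complex homogeneous.\<close>

definition num_range :: "'a::complex_banach_algebra_1 \<Rightarrow> complex set"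
  where "num_range c = {blinfun_apply \<phi> c | \<phi> :: 'a \<Rightarrow>\<^sub>L complex.
    (\<forall>z x. blinfun_apply \<phi> (z *\<^sub>C x) = z * blinfun_apply \<phi> x) \<and>
    norm \<phi> \<le> 1 \<and> blinfun_apply \<phi> 1 = 1}"

definition pos_elem :: "'a::complex_banach_algebra_1 \<Rightarrow> bool"
  where "pos_elem c \<longleftrightarrow> num_range c \<subseteq> complex_of_real ` {0..}"

text \<open>The unique positive square root. In a general Banach algebra not every positive element has
  one (the holomorphic square root of a hermitian element need not be hermitian); for the elements
  without it the notation \<open>c\<^sup>1\<^sup>/\<^sup>2\<close> has no meaning, and the function is given the value 1.\<close>

definition pos_sqrt :: "'a::complex_banach_algebra_1 \<Rightarrow> 'a"
  where "pos_sqrt c =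
    (if \<exists>!d. pos_elem d \<and> d * d = c then (THE d. pos_elem d \<and> d * d = c) else 1)"

definition wnorm :: "'a::complex_banach_algebra_1 \<Rightarrow> 'a \<Rightarrow> real"
  where "wnorm u x = norm (pos_sqrt u * x * alg_inv (pos_sqrt u))"

text \<open>\<open>hermitian_in N h\<close>: \<open>h\<close> is hermitian in the algebra renormed by the equivalent norm \<open>N\<close>;
  the exponential series has the same sum in both norms. Thus \<open>hermitian_in norm h\<close> is
  \<open>h \<in> H(A)\<close>, and \<open>hermitian_in (wnorm u) h\<close> is \<open>h \<in> H(A\<^sup>u)\<close>.\<close>

definition hermitian_in :: "('a \<Rightarrow> real) \<Rightarrow> 'a::complex_banach_algebra_1 \<Rightarrow> bool"
  where "hermitian_in N h \<longleftrightarrow> (\<forall>t::real. N (exp ((\<i> * complex_of_real t) *\<^sub>C h)) = 1)"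


section \<open>Generalized inverses\<close>

definition norm_gen_inverse :: "'a::complex_banach_algebra_1 \<Rightarrow> 'a \<Rightarrow> bool"
  where "norm_gen_inverse a b \<longleftrightarrow> a * b * a = a \<and> b * a * b = b"

definition is_wmp_inverse :: "'a::complex_banach_algebra_1 \<Rightarrow> 'a \<Rightarrow> 'a \<Rightarrow> 'a \<Rightarrow> bool"
  where "is_wmp_inverse e f a b \<longleftrightarrow>
    norm_gen_inverse a b \<and> hermitian_in (wnorm e) (a * b) \<and> hermitian_in (wnorm f) (b * a)"

definition wmp_invertible :: "'a::complex_banach_algebra_1 \<Rightarrow> 'a \<Rightarrow> 'a \<Rightarrow> bool"
  where "wmp_invertible e f a \<longleftrightarrow> (\<exists>b. is_wmp_inverse e f a b)"

definition wmp :: "'a::complex_banach_algebra_1 \<Rightarrow> 'a \<Rightarrow> 'a \<Rightarrow> 'a"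
  where "wmp e f a = (THE b. is_wmp_inverse e f a b)"

definition weighted_EP :: "'a::complex_banach_algebra_1 \<Rightarrow> 'a \<Rightarrow> 'a \<Rightarrow> bool"
  where "weighted_EP e f a \<longleftrightarrow> wmp_invertible e f a \<and> a * wmp e f a = wmp e f a * a"

definition is_group_inverse :: "'a::complex_banach_algebra_1 \<Rightarrow> 'a \<Rightarrow> bool"
  where "is_group_inverse a b \<longleftrightarrow> a * b * a = a \<and> b * a * b = b \<and> a * b = b * a"

definition group_invertible :: "'a::complex_banach_algebra_1 \<Rightarrow> bool"
  where "group_invertible a \<longleftrightarrow> (\<exists>b. is_group_inverse a b)"

definition group_inverse :: "'a::complex_banach_algebra_1 \<Rightarrow> 'a"
  where "group_inverse a = (THE b. is_group_inverse a b)"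


definition all_equivalent :: "bool list \<Rightarrow> bool"
  where "all_equivalent Ps \<longleftrightarrow> (\<forall>P\<in>set Ps. \<forall>Q\<in>set Ps. P \<longleftrightarrow> Q)"

end

theory Submission
  imports Defs
begin

text \<open>
  Let \<open>b\<close> be the weighted Moore-Penrose inverse and \<open>g\<close> the group inverse of \<open>a\<close>, and put \<open>p = a g\<close>,
  \<open>q = a b\<close>, \<open>r = b a\<close>. These are idempotents; \<open>q\<close> has the same range as \<open>p\<close> (\<open>p q = q\<close>, \<open>q p = p\<close>) and \<open>r\<close>
  has the same kernel as \<open>p\<close> (\<open>p r = p\<close>, \<open>r p = r\<close>). Since \<open>b = r g q\<close>, the inverses \<open>b\<close> and \<open>g\<close> are equal
  exactly when \<open>q = p\<close> and \<open>r = p\<close>. Every statement is shown to be equivalent to \<open>b = g\<close>.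

  Statements about \<open>a\<close>, \<open>b\<close> and \<open>g\<close> alone are ring theory. Relative to \<open>p\<close>, the differences
  \<open>x = q - p\<close> and \<open>y = r - p\<close> are the off-diagonal entries \<open>x = p x (1 - p)\<close> and \<open>y = (1 - p) y p\<close>, and \<open>a\<close> is
  invertible in the corner \<open>p A p\<close>. Multiplying an identity by \<open>a\<close> or by \<open>p\<close> on one side isolates an
  off-diagonal entry and shows that it vanishes (\<open>eq_group_inverseI_core\<close>). For inclusions of
  ideals and null spaces the entries are obtained one at a time (\<open>range_subset_iff\<close>, \<open>kernel_subset_iff\<close>).

  Analysis is needed in two places. The weighted Moore-Penrose inverse is unique because
  hermitian idempotents with the same range, or with the same kernel, coincide
  (\<open>hermitian_idempotents_eqI\<close>). Hence \<open>b = g\<close> holds exactly when \<open>p\<close> is hermitian for both weights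
  (\<open>hermitian_iff\<close>). This condition treats the weights separately and depends on \<open>a\<close> only through \<open>p\<close>,
  which is also the spectral idempotent of \<open>g\<close> and of each power \<open>a\<^sup>k\<close>; so it covers the statements with
  permuted or repeated weights and those about \<open>a\<^sup>k\<close> and \<open>g\<close>.

  For the holomorphic functional calculus, \<open>g = h(a)\<close> where \<open>h\<close> is 0 near 0 and \<open>z\<^sup>-\<^sup>1\<close> on the rest of the
  spectrum (\<open>group_inverse_hol_calc\<close>); conversely every \<open>h(a)\<close> commutes with \<open>a\<close> (\<open>hol_calc_commute\<close>), and
  \<open>b\<close> commutes with \<open>a\<close> only if \<open>b = g\<close>.
\<close>

section \<open>Group inverse and generalized inverse in a ring\<close>

locale group_and_generalized_inverse =
  fixes a b g :: "'a::ring_1"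
  assumes aba: "a * b * a = a" and bab: "b * a * b = b"
    and aga: "a * g * a = a" and gag: "g * a * g = g" and ag_commute: "a * g = g * a"
begin

text \<open>With the idempotents \<open>p = a g\<close>, \<open>q = a b\<close>, \<open>r = b a\<close> these rules say that \<open>q\<close> is the identity on
  \<open>a A = p A\<close>, that \<open>r\<close> is a right identity on \<open>A a = A p\<close>, and that \<open>g\<close> is the inverse of \<open>a\<close>
  in the corner \<open>p A p\<close>. Right-associated, they reduce words in \<open>a, b, g\<close> by rewriting.\<close>

lemma word_simps:
  "a * (b * a) = a" "a * (b * (a * x)) = a * x"
  "b * (a * b) = b" "b * (a * (b * x)) = b * x"
  "g * a = a * g" "g * (a * x) = a * (g * x)"
  "a * (a * g) = a" "a * (a * (g * x)) = a * x"
  "a * (g * g) = g" "a * (g * (g * x)) = g * x"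
  "a * (b * g) = g" "a * (b * (g * x)) = g * x"
  "g * (b * a) = g" "g * (b * (a * x)) = g * x"
  "a * (g * (b * a)) = a * g" "a * (g * (b * (a * x))) = a * (g * x)"
  "a * (g * (b * g)) = g * g" "a * (g * (b * (g * x))) = g * (g * x)"
proof -
  show 1: "a * (b * a) = a" "b * (a * b) = b" "g * a = a * g"
    using aba bab ag_commute by (simp_all add: mult.assoc)
  show 2: "a * (a * g) = a" "a * (g * g) = g"
    using aga gag ag_commute by (metis mult.assoc)+
  show 3: "a * (b * g) = g" using 1 2 aba by (metis mult.assoc)
  show 4: "g * (b * a) = g" using 1 2 aba gag by (metis mult.assoc)
  show "a * (b * (a * x)) = a * x" "b * (a * (b * x)) = b * x" "g * (a * x) = a * (g * x)"
    "a * (a * (g * x)) = a * x" "a * (g * (g * x)) = g * x" "a * (b * (g * x)) = g * x"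
    "g * (b * (a * x)) = g * x"
    "a * (g * (b * a)) = a * g" "a * (g * (b * (a * x))) = a * (g * x)"
    "a * (g * (b * g)) = g * g" "a * (g * (b * (g * x))) = g * (g * x)"
    using 1 2 3 4 by (metis mult.assoc)+
qed

lemmas words = mult.assoc word_simps

text \<open>The hypotheses say \<open>r p = p\<close> and \<open>p q = p\<close>. As \<open>p r = p\<close>, \<open>r p = r\<close>, \<open>q p = p\<close> and \<open>p q = q\<close> hold
  anyway, they force \<open>r = p = q\<close>, and then \<open>b = b a b = g a b = g\<close>.\<close>

lemma eq_group_inverseI:
  assumes "b * a * a = a" and "a * a * b = a"
  shows "b = g"
proof -
  have "b * a = a * g"
    using arg_cong[OF assms(1), of "\<lambda>x. x * g"] by (simp add: words)
  moreover have "a * b = a * g"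
    using arg_cong[OF assms(2), of "\<lambda>x. g * x"] by (simp add: words)
  ultimately show ?thesis
    by (metis bab gag ag_commute mult.assoc)
qed

text \<open>An equation \<open>r x = x\<close> gives \<open>r p = p\<close> as soon as \<open>x y = p\<close> for some \<open>y\<close>; with the mirror
  image below this lets any power of \<open>a\<close> or \<open>g\<close> take the place of \<open>a\<close>.\<close>

lemma range_condition:
  assumes "b * a * x = x" and "x * y = a * g"
  shows "b * a * a = a"
proof -
  have "b * a * (a * g) = a * g" using assms by (metis mult.assoc)
  then have "b * a * (a * g) * a = a * g * a" by simp
  then show ?thesis by (simp add: words)
qed

lemma kernel_condition:
  assumes "x * (a * b) = x" and "y * x = a * g"
  shows "a * a * b = a"
proof -
  have "a * g * (a * b) = a * g" using assms by (metis mult.assoc)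
  then have "a * (a * g * (a * b)) = a * (a * g)" by simp
  then show ?thesis by (simp add: words)
qed

text \<open>The same rules with \<open>a\<close>, \<open>g\<close> or \<open>b\<close> replaced by a positive power: \<open>a\<^sup>k\<close> and \<open>g\<^sup>k\<close> lie in the corner
  \<open>p A p\<close> and are inverse to each other there.\<close>

lemma pow_words:
  assumes "k \<ge> 1"
  shows "a ^ k * g ^ k = a * g" "g ^ k * a ^ k = a * g"
    "a ^ k * (g ^ k * x) = a * (g * x)" "g ^ k * (a ^ k * x) = a * (g * x)"
    "a * (b * a ^ k) = a ^ k" "a * (b * g ^ k) = g ^ k"
    "a * (b * (a ^ k * x)) = a ^ k * x" "a * (b * (g ^ k * x)) = g ^ k * x"
    "a ^ k * (b * a) = a ^ k" "g ^ k * (b * a) = g ^ k"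
    "a ^ k * (b * (a * x)) = a ^ k * x" "g ^ k * (b * (a * x)) = g ^ k * x"
    "b * (a * b ^ k) = b ^ k" "b ^ k * (a * b) = b ^ k"
    "a * (g * a ^ k) = a ^ k" "a * (g * g ^ k) = g ^ k"
    "a * (g * (a ^ k * x)) = a ^ k * x" "a * (g * (g ^ k * x)) = g ^ k * x"
    "a ^ k * (a * g) = a ^ k" "g ^ k * (a * g) = g ^ k"
    "a ^ k * (a * (g * x)) = a ^ k * x" "g ^ k * (a * (g * x)) = g ^ k * x"
proof -
  obtain m where m: "k = Suc m" using assms by (cases k) auto
  have left: "a ^ k = a * a ^ m" "g ^ k = g * g ^ m" "b ^ k = b * b ^ m" by (simp_all add: m)
  have right: "a ^ k = a ^ m * a" "g ^ k = g ^ m * g" "b ^ k = b ^ m * b"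
    by (simp_all add: m power_Suc2 del: power_Suc)
  show pg: "a ^ k * g ^ k = a * g" unfolding m
  proof (induction m)
    case (Suc n)
    have "a ^ Suc (Suc n) * g ^ Suc (Suc n) = a * (a ^ Suc n * g ^ Suc n) * g"
      by (simp add: power_Suc2[of g "Suc n"] mult.assoc del: power_Suc)
        (simp add: mult.assoc)
    also have "\<dots> = a * g" by (simp only: Suc) (simp add: words)
    finally show ?case .
  qed simp
  show gp: "g ^ k * a ^ k = a * g"
    using pg ag_commute by (metis power_commuting_commutes)
  show "a ^ k * (g ^ k * x) = a * (g * x)" "g ^ k * (a ^ k * x) = a * (g * x)"
    using pg gp by (metis mult.assoc)+
  show "a * (b * a ^ k) = a ^ k" "a * (b * g ^ k) = g ^ k"
    "a * (b * (a ^ k * x)) = a ^ k * x" "a * (b * (g ^ k * x)) = g ^ k * x"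
    "b * (a * b ^ k) = b ^ k"
    "a * (g * a ^ k) = a ^ k" "a * (g * g ^ k) = g ^ k"
    "a * (g * (a ^ k * x)) = a ^ k * x" "a * (g * (g ^ k * x)) = g ^ k * x"
    unfolding left by (simp_all add: words)
  show "a ^ k * (b * a) = a ^ k" "g ^ k * (b * a) = g ^ k"
    "a ^ k * (b * (a * x)) = a ^ k * x" "g ^ k * (b * (a * x)) = g ^ k * x"
    "b ^ k * (a * b) = b ^ k"
    "a ^ k * (a * g) = a ^ k" "g ^ k * (a * g) = g ^ k"
    "a ^ k * (a * (g * x)) = a ^ k * x" "g ^ k * (a * (g * x)) = g ^ k * x"
    unfolding right by (simp_all add: words)
qed

text \<open>The form in which the equations below are used: some \<open>x\<close> with \<open>r x = x\<close> and some \<open>y\<close> with \<open>y q = y\<close>,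
  where \<open>x\<close> and \<open>y\<close> are \<open>a\<close> or \<open>g\<close> or powers of them.\<close>

lemma eq_group_inverseI_core:
  assumes "b * a * x = x" "y * (a * b) = y" and "x * x' = a * g" "y' * y = a * g"
  shows "b = g"
  using assms by (intro eq_group_inverseI range_condition kernel_condition)

lemmas eq_group_inverseI_apow = eq_group_inverseI_core[OF _ _ pow_words(1,2)]
lemmas eq_group_inverseI_gpow = eq_group_inverseI_core[OF _ _ pow_words(2,1)]

lemma commute_iff: "a * b = b * a \<longleftrightarrow> b = g"
proof
  assume *: "a * b = b * a"
  show "b = g"
    by (rule eq_group_inverseI) (use * in \<open>metis aba mult.assoc\<close>)+
qed (simp add: ag_commute)


lemma eq_group_inverseI':
  assumes "b * a = a * g" and "a * b = a * g"
  shows "b = g"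
  using assms commute_iff by simp

lemma ba_eq_iff: "b * a * a = a \<longleftrightarrow> b * a = a * g"
proof
  assume "b * a * a = a"
  from arg_cong[OF this, of "\<lambda>x. x * g"] show "b * a = a * g" by (simp add: words)
qed (simp add: words)

lemma ab_eq_iff: "a * a * b = a \<longleftrightarrow> a * b = a * g"
proof
  assume "a * a * b = a"
  from arg_cong[OF this, of "\<lambda>x. g * x"] show "a * b = a * g" by (simp add: words)
qed (simp add: words)

lemma eq_group_inverse_iff: "b * a = a * g \<and> a * b = a * g \<longleftrightarrow> b = g"
  using eq_group_inverseI' ag_commute by auto

text \<open>The equations say \<open>q b = b\<close> and \<open>b r = b\<close>. The first puts \<open>b\<close> into \<open>p A\<close>, so \<open>p b = b\<close> and \<open>r = p r = p\<close>; the
  second is its mirror image.\<close>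

lemma square_absorbed_iff: "b = a * b^2 \<and> a * b^2 = b^2 * a \<longleftrightarrow> b = g"
proof
  assume *: "b = a * b^2 \<and> a * b^2 = b^2 * a"
  then have ab: "a * (b * b) = b" and ba: "b * (b * a) = b"
    by (metis mult.assoc power2_eq_square)+
  have "a * (g * b) = b"
  proof -
    have "a * (g * b) = a * (g * (a * (b * b)))" by (simp only: ab)
    also have "\<dots> = a * (b * b)" by (simp add: words)
    finally show ?thesis by (simp only: ab)
  qed
  from arg_cong[OF this, of "\<lambda>x. x * a"] have 1: "b * a = a * g" by (simp add: words)
  have "b * (a * g) = b"
  proof -
    have "b * (a * g) = b * (b * a) * (a * g)" by (simp only: ba)
    also have "\<dots> = b * (b * a)" by (simp add: words)
    finally show ?thesis by (simp only: ba)
  qed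
  from arg_cong[OF this, of "\<lambda>x. a * x"] have 2: "a * b = a * g" by (simp add: words)
  from 1 2 show "b = g" by (rule eq_group_inverseI')
next
  assume "b = g"
  show "b = a * b^2 \<and> a * b^2 = b^2 * a" unfolding \<open>b = g\<close> by (simp add: words power2_eq_square)
qed

lemma square_times_group_inverse_iff: "b^2 * g = b * g * b \<and> b * g * b = g * b^2 \<longleftrightarrow> b = g"
proof
  assume *: "b^2 * g = b * g * b \<and> b * g * b = g * b^2"
  then have 1: "b * (b * g) = b * (g * b)" and 2: "b * (g * b) = g * (b * b)"
    by (simp_all add: power2_eq_square mult.assoc)
  \<comment> \<open>The term \<open>b b g\<close> absorbs \<open>p\<close> on the right, hence so does \<open>b g b\<close>; dually for \<open>g b b\<close> below.\<close>
  have "b * (g * b) = b * (g * b) * (a * g)"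
    using arg_cong[OF 1, of "\<lambda>x. x * (a * g)"] unfolding 1[symmetric] by (simp add: words)
  from arg_cong[OF this, of "\<lambda>x. a * (a * x)"] have ab: "a * (g * b) = g" by (simp add: words)
  have "b * (g * b) = a * g * (b * (g * b))"
    using arg_cong[OF 2, of "\<lambda>x. a * g * x"] unfolding 2 by (simp add: words)
  from arg_cong[OF this, of "\<lambda>x. x * a"] have "b * g = g * g" by (simp add: words)
  from arg_cong[OF this, of "\<lambda>x. x * a"] have ba: "b * (a * g) = g" by (simp add: words)
  show "b = g"
    by (rule eq_group_inverseI_core[of g g a a]) (simp_all add: words ab ba)
next
  assume "b = g"
  show "b^2 * g = b * g * b \<and> b * g * b = g * b^2"
    unfolding \<open>b = g\<close> by (simp add: words power2_eq_square)
qed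

lemma square_eq_group_inverse_iff: "a * b^2 = g \<and> g = b^2 * a \<longleftrightarrow> b = g"
proof
  assume *: "a * b^2 = g \<and> g = b^2 * a"
  then have 1: "a * (b * b) = g" and 2: "b * (b * a) = g"
    by (simp_all add: power2_eq_square mult.assoc)
  have ba: "b * (a * g) = g" unfolding 2[symmetric] by (simp add: words)
  have ab: "g * (a * b) = g" unfolding 1[symmetric] by (simp add: words)
  show "b = g"
    by (rule eq_group_inverseI_core[of g g a a]) (use ab in \<open>simp_all add: words ba\<close>)
next
  assume "b = g"
  show "a * b^2 = g \<and> g = b^2 * a" unfolding \<open>b = g\<close> by (simp add: words power2_eq_square)
qed

text \<open>The hypothesis is \<open>q r = r\<close>, which puts the range of \<open>r\<close> inside that of \<open>q\<close>, and hence inside that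
  of \<open>p\<close>: so \<open>r = p r = p\<close>. The next lemma is the mirror image.\<close>

lemma ba_eqI:
  assumes "a * b * b * a = b * a"
  shows "b * a = a * g"
proof -
  have "a * b * b * a = a * g * (a * b * b * a)" by (simp add: words)
  then have "b * a = a * g * (b * a)" by (simp only: assms)
  then show ?thesis by (simp add: words)
qed

lemma ab_eqI:
  assumes "a * b * b * a = a * b"
  shows "a * b = a * g"
proof -
  have "a * b * b * a = a * b * b * a * (a * g)" by (simp add: words)
  then have "a * b = a * b * (a * g)" by (simp only: assms)
  then show ?thesis by (simp add: words)
qed

text \<open>This is \<open>q r = r q\<close>. Right multiplication by \<open>p\<close> turns \<open>r q\<close> into \<open>r\<close>, left multiplication turns it into \<open>q\<close>,
  and both leave \<open>q r\<close> unchanged.\<close>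

lemma projections_commute_iff: "a * b * b * a = b * a * a * b \<longleftrightarrow> b = g"
proof
  assume *: "a * b * b * a = b * a * a * b"
  have "a * b * b * a = b * a" using arg_cong[OF *, of "\<lambda>x. x * (a * g)"] by (simp add: words)
  moreover have "a * b * b * a = a * b" using arg_cong[OF *, of "\<lambda>x. a * g * x"] by (simp add: words)
  ultimately show "b = g" by (intro eq_group_inverseI' ba_eqI ab_eqI)
qed (simp add: words)

lemma commute_spectral_projection_iff: "a * g * b = b * g * a \<longleftrightarrow> b = g"
proof
  assume *: "a * g * b = b * g * a"
  have "a * b = a * g" using arg_cong[OF *, of "\<lambda>x. a * x"] by (simp add: words)
  moreover have "b * a = a * g" using arg_cong[OF *, of "\<lambda>x. x * a"] by (simp add: words)
  ultimately show "b = g" by (intro eq_group_inverseI')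
qed (simp add: words)

text \<open>The group inverse lies in the bicommutant of \<open>a\<close>: if \<open>c\<close> commutes with \<open>a\<close>, then \<open>c p = p c p\<close>
  because \<open>c\<close> preserves \<open>a A\<close>, and \<open>p c = p c p\<close> because right multiplication by \<open>c\<close> preserves \<open>A a\<close>;
  so \<open>c\<close> commutes with \<open>p\<close> and with the inverse of \<open>a\<close>
  in \<open>p A p\<close>. Conversely \<open>c = a\<close> gives \<open>a b = b a\<close>.\<close>

lemma bicommutant_iff: "(\<forall>c. a * c = c * a \<longrightarrow> b * c = c * b) \<longleftrightarrow> b = g"
proof
  assume "b = g"
  have "g * c = c * g" if c: "a * c = c * a" for c
  proof -
    have "c * (a * g) = a * (c * g)" by (simp only: mult.assoc[symmetric] c)
    then have l: "a * (g * (c * (a * g))) = c * (a * g)" by (simp add: words)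
    have e: "a * (g * c) = g * (c * a)" by (simp only: c[symmetric] mult.assoc[symmetric] ag_commute)
    have "a * (g * c) * (a * g) = a * (g * c)" unfolding e by (simp add: words)
    with l have central: "c * (a * g) = a * (g * c)" by (simp add: mult.assoc)
    have "g * c = g * (a * (g * c))" by (simp add: words)
    also have "\<dots> = g * (c * a) * g" by (simp only: central[symmetric] mult.assoc)
    also have "\<dots> = c * (a * g) * g" by (simp only: e[symmetric] central)
    also have "\<dots> = c * g" by (simp add: words)
    finally show ?thesis .
  qed
  then show "\<forall>c. a * c = c * a \<longrightarrow> b * c = c * b" using \<open>b = g\<close> by blast
qed (use commute_iff in auto)

lemma sum_projected_iff: "b * g * a + a * g * b = 2 * b \<longleftrightarrow> b = g"
proof
  assume *: "b * g * a + a * g * b = 2 * b"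
  have 1: "a * (b * g * a + a * g * b) = a * (2 * b)" by (simp only: *)
  have 2: "(b * g * a + a * g * b) * a = (2 * b) * a" by (simp only: *)
  show "b = g"
  proof (rule eq_group_inverseI)
    show "b * a * a = a"
    proof (rule range_condition)
      show "b * a * (a * g) = a * g"
        using 2 by (simp add: words algebra_simps mult_2)
      show "a * g * (a * g) = a * g" by (simp add: words)
    qed
    show "a * a * b = a"
    proof (rule kernel_condition)
      show "a * g * (a * b) = a * g"
        using 1 by (simp add: words algebra_simps mult_2)
      show "a * g * (a * g) = a * g" by (simp add: words)
    qed
  qed
next
  assume "b = g"
  show "b * g * a + a * g * b = 2 * b" unfolding \<open>b = g\<close> by (simp add: words mult_2)
qed

context
  fixes k :: nat
  assumes k: "k \<ge> 1"
begin

text \<open>\<open>b\<^sup>k = r b\<^sup>k = b\<^sup>k q\<close>, so the equation makes \<open>x = g\<^sup>k\<close> satisfy \<open>r x = x = x q\<close>.\<close>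

lemma power_eq_iff: "b^k = g^k \<longleftrightarrow> b = g"
proof
  assume *: "b^k = g^k"
  show "b = g"
    by (rule eq_group_inverseI_gpow[OF _ _ k k])
      (simp_all add: *[symmetric] pow_words[OF k] mult.assoc)
qed simp

lemma power_eq_projected_iff: "g^k * b * a = b^k \<longleftrightarrow> b = g"
proof -
  have "g^k * b * a = g^k" by (simp add: pow_words[OF k] mult.assoc)
  then show ?thesis using power_eq_iff by auto
qed

lemma power_fixed_iff: "a^k = b * a * a^k \<and> b * a * a^k = a^k * a * b \<longleftrightarrow> b = g"
proof
  assume *: "a^k = b * a * a^k \<and> b * a * a^k = a^k * a * b"
  then have 1: "b * a * a^k = a^k" and 2: "a^k * (a * b) = a^k" by (metis mult.assoc)+
  show "b = g" by (rule eq_group_inverseI_apow[OF 1 2 k k])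
next
  assume "b = g"
  show "a^k = b * a * a^k \<and> b * a * a^k = a^k * a * b"
    unfolding \<open>b = g\<close> by (simp add: pow_words[OF k] words)
qed

lemma commute_group_power_iff: "g^k * b = b * g^k \<longleftrightarrow> b = g"
proof
  have c: "g^k * a = a * g^k" by (metis power_commuting_commutes ag_commute)
  assume *: "g^k * b = b * g^k"
  have "a * (g^k * b) = g^k"
    using arg_cong[OF *, of "\<lambda>x. a * x"] by (simp add: pow_words[OF k] mult.assoc)
  then have 1: "g^k * (a * b) = g^k" by (metis c mult.assoc)
  have "g^k = b * (g^k * a)"
    using arg_cong[OF *, of "\<lambda>x. x * a"] by (simp add: pow_words[OF k] mult.assoc)
  then have 2: "b * a * g^k = g^k" by (metis c mult.assoc)
  show "b = g"
    by (rule eq_group_inverseI_gpow[OF 2 1 k k])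
qed (simp add: power_commutes)

lemma commute_power_iff: "a^k * b = b * a^k \<longleftrightarrow> b = g"
proof
  assume *: "a^k * b = b * a^k"
  have "a * (a^k * b) = a^k"
    using arg_cong[OF *, of "\<lambda>x. a * x"] by (simp add: pow_words[OF k] mult.assoc)
  then have 1: "a^k * (a * b) = a^k" by (metis power_commutes mult.assoc)
  have "a^k = b * (a^k * a)"
    using arg_cong[OF *, of "\<lambda>x. x * a"] by (simp add: pow_words[OF k] mult.assoc)
  then have 2: "b * a * a^k = a^k" by (metis power_commutes mult.assoc)
  show "b = g"
    by (rule eq_group_inverseI_apow[OF 2 1 k k])
next
  assume "b = g"
  then show "a^k * b = b * a^k" by (metis power_commuting_commutes ag_commute)
qed

text \<open>Since \<open>b = r b = b q\<close>, the equation makes \<open>x = a\<^sup>2\<^sup>k\<^sup>-\<^sup>1\<close> satisfy \<open>r x = x = x q\<close>. The other power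
  identities below are read in the same way.\<close>

lemma odd_power_sandwich_iff: "a^(2 * k - 1) = b * a^(2 * k + 1) * b \<longleftrightarrow> b = g"
proof -
  have m: "2 * k - 1 \<ge> 1" using k by simp
  show ?thesis
  proof
    let ?X = "a^(2 * k - 1)"
    assume *: "?X = b * a^(2 * k + 1) * b"
    have 1: "b * a * ?X = ?X" unfolding * by (simp only: words)
    have 2: "?X * (a * b) = ?X" unfolding * by (simp only: words)
    show "b = g"
      by (rule eq_group_inverseI_apow[OF 1 2 m m])
  next
    have "2 * k + 1 = Suc (Suc (2 * k - 1))" using k by simp
    then have e: "a^(2 * k + 1) = a * a^(2 * k - 1) * a"
      by (metis power_Suc power_Suc2 mult.assoc)
    assume "b = g"
    show "a^(2 * k - 1) = b * a^(2 * k + 1) * b"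
      unfolding \<open>b = g\<close> e by (simp add: pow_words[OF m] words del: One_nat_def)
  qed
qed

lemma power_absorbed_iff: "a * b^(k + 1) = g^k \<and> g^k = b^(k + 1) * a \<longleftrightarrow> b = g"
proof
  have k1: "k + 1 \<ge> 1" by simp
  assume *: "a * b^(k + 1) = g^k \<and> g^k = b^(k + 1) * a"
  have 1: "b * a * g^k = g^k"
    unfolding conjunct2[OF *] using pow_words(13)[OF k1] by (metis mult.assoc)
  have 2: "g^k * (a * b) = g^k"
    unfolding conjunct1[OF *, symmetric] using pow_words(14)[OF k1] by (metis mult.assoc)
  show "b = g"
    by (rule eq_group_inverseI_gpow[OF 1 2 k k])
next
  assume "b = g"
  have "a * g^(k + 1) = g^k" by (simp add: pow_words[OF k])
  moreover have "g^(k + 1) * a = a * g^(k + 1)" by (metis power_commuting_commutes ag_commute)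
  ultimately show "a * b^(k + 1) = g^k \<and> g^k = b^(k + 1) * a"
    using \<open>b = g\<close> by simp
qed

lemma power_sum_projected_iff: "a^k * a * b + b * a * a^k = 2 * a^k \<longleftrightarrow> b = g"
proof
  assume *: "a^k * a * b + b * a * a^k = 2 * a^k"
  have 1: "b * a * a^k = a^k"
    using arg_cong[OF *, of "\<lambda>x. x * (a * g)"]
    by (simp add: pow_words[OF k] words algebra_simps mult_2)
  have 2: "a^k * (a * b) = a^k"
    using arg_cong[OF *, of "\<lambda>x. a * g * x"]
    by (simp add: pow_words[OF k] words algebra_simps mult_2)
  show "b = g"
    by (rule eq_group_inverseI_apow[OF 1 2 k k])
next
  assume "b = g"
  show "a^k * a * b + b * a * a^k = 2 * a^k"
    unfolding \<open>b = g\<close> by (simp add: pow_words[OF k] words mult_2)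
qed

end

lemma mixed_powers_iff:
  assumes k: "k \<ge> 1" and l: "l \<ge> 1"
  shows
  "g^(k + l - 1) = b^l * g^(k - 1) \<and> b^l * g^(k - 1) = g^(k - 1) * b^l \<longleftrightarrow> b = g"
proof
  have m: "k + l - 1 \<ge> 1" using k l by simp
  assume *: "g^(k + l - 1) = b^l * g^(k - 1) \<and> b^l * g^(k - 1) = g^(k - 1) * b^l"
  then have r: "g^(k + l - 1) = g^(k - 1) * b^l" by simp
  have 1: "b * a * g^(k + l - 1) = g^(k + l - 1)"
    unfolding conjunct1[OF *] using pow_words(13)[OF l] by (metis mult.assoc)
  have 2: "g^(k + l - 1) * (a * b) = g^(k + l - 1)"
    unfolding r using pow_words(14)[OF l] by (metis mult.assoc)
  show "b = g"
    by (rule eq_group_inverseI_gpow[OF 1 2 m m])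
next
  have "k + l - 1 = l + (k - 1)" "k + l - 1 = (k - 1) + l" using k by simp_all
  then have "g^(k + l - 1) = g^l * g^(k - 1)" "g^(k + l - 1) = g^(k - 1) * g^l"
    by (metis power_add)+
  moreover assume "b = g"
  ultimately show "g^(k + l - 1) = b^l * g^(k - 1) \<and> b^l * g^(k - 1) = g^(k - 1) * b^l" by simp
qed

lemma mixed_powers_projected_iff:
  assumes k: "k \<ge> 1" and l: "l \<ge> 1"
  shows
  "a * b * g^(k + l - 1) = b^k * g^l * a \<and> b^k * g^l * a = g^l * a * b^k \<longleftrightarrow> b = g"
proof -
  have m: "k + l - 1 \<ge> 1" using k l by simp
  have c: "a * b * g^(k + l - 1) = g^(k + l - 1)" by (simp add: pow_words[OF m] mult.assoc del: One_nat_def)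
  show ?thesis unfolding c
  proof
    assume *: "g^(k + l - 1) = b^k * g^l * a \<and> b^k * g^l * a = g^l * a * b^k"
    then have r: "g^(k + l - 1) = g^l * a * b^k" by simp
    have 1: "b * a * g^(k + l - 1) = g^(k + l - 1)"
      unfolding conjunct1[OF *] using pow_words(13)[OF k] by (metis mult.assoc)
    have 2: "g^(k + l - 1) * (a * b) = g^(k + l - 1)"
      unfolding r using pow_words(14)[OF k] by (metis mult.assoc)
    show "b = g"
      by (rule eq_group_inverseI_gpow[OF 1 2 m m])
  next
    have "k + l = Suc (k + l - 1)" using k by simp
    then have e: "g^k * g^l = g * g^(k + l - 1)" "g^l * g^k = g^(k + l - 1) * g"
      by (metis power_add power_Suc, metis power_add power_Suc2 add.commute)
    have ca: "g^n * a = a * g^n" for n by (metis power_commuting_commutes ag_commute)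
    have "g^k * g^l * a = a * (g * g^(k + l - 1))" unfolding e by (metis ca ag_commute mult.assoc)
    moreover have "g^l * a * g^k = a * (g * g^(k + l - 1))"
      unfolding ca by (simp only: mult.assoc e power_commutes)
    moreover assume "b = g"
    ultimately show "g^(k + l - 1) = b^k * g^l * a \<and> b^k * g^l * a = g^l * a * b^k"
      by (simp add: pow_words[OF m] del: One_nat_def)
  qed
qed

end

section \<open>Complex scalars, inverses and square roots\<close>

lemma scaleC_one [simp]: "1 *\<^sub>C x = (x :: 'a::complex_banach_algebra_1)"
  using scaleC_of_real[of 1 x] by simp

lemma bounded_bilinear_scaleC:
  "bounded_bilinear (scaleC :: complex \<Rightarrow> 'a \<Rightarrow> 'a::complex_banach_algebra_1)"
proof
  fix z w :: complex and x y :: 'a and r :: real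
  show "(z + w) *\<^sub>C x = z *\<^sub>C x + w *\<^sub>C x" by (rule scaleC_add_left)
  show "z *\<^sub>C (x + y) = z *\<^sub>C x + z *\<^sub>C y" by (rule scaleC_add_right)
  show "(r *\<^sub>R z) *\<^sub>C x = r *\<^sub>R (z *\<^sub>C x)"
    using scaleC_of_real[of r "z *\<^sub>C x"] by (simp add: scaleR_conv_of_real scaleC_scaleC)
  show "z *\<^sub>C (r *\<^sub>R x) = r *\<^sub>R (z *\<^sub>C x)"
    using scaleC_of_real[of r x] scaleC_of_real[of r "z *\<^sub>C x"]
    by (metis scaleC_scaleC mult.commute)
  show "\<exists>K. \<forall>z (x::'a). norm (z *\<^sub>C x) \<le> norm z * norm x * K"
    by (rule exI[of _ 1]) (simp add: norm_scaleC)
qed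

interpretation scaleC: bounded_bilinear
  "scaleC :: complex \<Rightarrow> 'a \<Rightarrow> 'a::complex_banach_algebra_1"
  by (rule bounded_bilinear_scaleC)

declare scaleC.zero_left [simp] scaleC.zero_right [simp]

lemmas scaleC_simps = scaleC_scaleC mult_scaleC_left mult_scaleC_right
  scaleC.add_left scaleC.add_right scaleC.diff_left scaleC.diff_right
  scaleC.minus_left scaleC.minus_right

lemma scaleC_cancel: "z \<noteq> 0 \<Longrightarrow> z *\<^sub>C x = z *\<^sub>C y \<Longrightarrow> x = (y :: 'a::complex_banach_algebra_1)"
  by (metis scaleC_scaleC scaleC_one left_inverse)

lemma scaleC_power: "(z *\<^sub>C x) ^ n = z ^ n *\<^sub>C (x ^ n :: 'a::complex_banach_algebra_1)"
  by (induction n) (simp_all add: scaleC_simps mult.commute)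

lemma alg_inv_eqI:
  assumes "x * y = 1" "y * x = (1 :: 'a::complex_banach_algebra_1)"
  shows "alg_inv x = y"
  unfolding alg_inv_def
proof (rule the_equality)
  fix y' assume "x * y' = 1 \<and> y' * x = 1"
  then show "y' = y" using assms by (metis mult.assoc mult_1_left mult_1_right)
qed (use assms in blast)

lemma alg_inv:
  assumes "x \<in> inv_elems"
  shows "x * alg_inv x = 1" "alg_inv x * x = (1 :: 'a::complex_banach_algebra_1)"
proof -
  obtain y where y: "x * y = 1" "y * x = 1" using assms by (auto simp: inv_elems_def)
  show "x * alg_inv x = 1" "alg_inv x * x = 1" using y alg_inv_eqI[OF y] by simp_all
qed

text \<open>A square root of an invertible element is invertible, and the default value 1 is invertible too.\<close>

lemma pos_sqrt_invertible:
  assumes "u \<in> inv_elems"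
  shows "pos_sqrt u \<in> (inv_elems :: 'a::complex_banach_algebra_1 set)"
proof (cases "\<exists>!d. pos_elem d \<and> d * d = u")
  case True
  then have "pos_sqrt u * pos_sqrt u = u"
    unfolding pos_sqrt_def using theI'[OF True] by simp
  then have 1: "pos_sqrt u * (pos_sqrt u * alg_inv u) = 1" "(alg_inv u * pos_sqrt u) * pos_sqrt u = 1"
    using alg_inv[OF assms] by (metis mult.assoc)+
  then have "pos_sqrt u * alg_inv u * pos_sqrt u = 1"
    by (metis mult.assoc mult_1_left mult_1_right)
  with 1(1) show ?thesis unfolding inv_elems_def by blast
next
  case False
  then show ?thesis by (auto simp: pos_sqrt_def inv_elems_def)
qed

section \<open>Hermitian idempotents and uniqueness of inverses\<close>

text \<open>All powers \<open>q\<^sup>n\<close> with \<open>n \<ge> 1\<close> equal \<open>q\<close>, so the series is the scalar one times \<open>q\<close>, except for its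
  constant term.\<close>

lemma exp_scaleC_idempotent:
  fixes q :: "'a::complex_banach_algebra_1"
  assumes "q * q = q"
  shows "exp (z *\<^sub>C q) = 1 + (exp z - 1) *\<^sub>C q"
proof -
  have pow: "q ^ Suc n = q" for n
    by (induction n) (simp_all add: assms)
  have "(\<lambda>n. (z ^ n /\<^sub>R fact n) *\<^sub>C q) sums (exp z *\<^sub>C q)"
    by (rule bounded_linear.sums[OF scaleC.bounded_linear_left exp_converges])
  moreover have "(\<lambda>n. if n = 0 then 1 - q else 0) sums (1 - q)"
    using sums_single[of 0 "\<lambda>_. 1 - q"] by simp
  ultimately have "(\<lambda>n. (z ^ n /\<^sub>R fact n) *\<^sub>C q + (if n = 0 then 1 - q else 0)) sums (exp z *\<^sub>C q + (1 - q))"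
    by (rule sums_add)
  moreover have "(\<lambda>n. (z ^ n /\<^sub>R fact n) *\<^sub>C q + (if n = 0 then 1 - q else 0))
      = (\<lambda>n. (z *\<^sub>C q) ^ n /\<^sub>R fact n)"
  proof
    fix n show "(z ^ n /\<^sub>R fact n) *\<^sub>C q + (if n = 0 then 1 - q else 0) = (z *\<^sub>C q) ^ n /\<^sub>R fact n"
      by (cases n) (simp_all add: scaleC_power pow scaleC.scaleR_left del: power_Suc)
  qed
  ultimately have "exp (z *\<^sub>C q) = exp z *\<^sub>C q + (1 - q)"
    using sums_unique2[OF _ exp_converges] by metis
  then show ?thesis by (simp add: scaleC_simps)
qed

text \<open>At \<open>t = \<pi>\<close> the exponential of \<open>\<i> t q\<close> is the reflection \<open>1 - 2 q\<close>.\<close>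

lemma hermitian_idempotent_reflection:
  fixes q :: "'a::complex_banach_algebra_1"
  assumes "hermitian_in N q" and "q * q = q"
  shows "N (1 - 2 * q) = 1"
proof -
  have "exp ((\<i> * complex_of_real pi) *\<^sub>C q) = 1 + (- 2) *\<^sub>C q"
    by (simp add: exp_scaleC_idempotent[OF assms(2)] exp_pi_i')
  also have "\<dots> = 1 - 2 * q"
    using scaleC_of_real[of "2" q] by (simp add: scaleC_simps scaleR_2 mult_2)
  finally show ?thesis using assms(1) unfolding hermitian_in_def by metis
qed

text \<open>The powers \<open>(1 + w)\<^sup>m = 1 + m w\<close> stay in the unit ball while \<open>m w\<close> grows linearly.\<close>

lemma square_zero_eq_0:
  fixes w :: "'a::real_normed_algebra_1"
  assumes "w * w = 0" and "norm (1 + w) \<le> 1"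
  shows "w = 0"
proof (rule ccontr)
  assume "w \<noteq> 0"
  have "(1 + w) ^ m = 1 + real m *\<^sub>R w" for m
    by (induction m) (simp_all add: algebra_simps assms(1))
  moreover have "norm ((1 + w) ^ m) \<le> 1" for m
    using norm_power_ineq[of "1 + w" m] power_le_one[OF norm_ge_zero assms(2)] by (meson order_trans)
  ultimately have *: "norm (1 + real m *\<^sub>R w) \<le> 1" for m by simp
  have "real m * norm w \<le> 2" for m
  proof -
    have "real m * norm w = norm (real m *\<^sub>R w)" by simp
    also have "\<dots> \<le> norm (1 + real m *\<^sub>R w) + norm (1::'a)"
      using norm_triangle_ineq4[of "1 + real m *\<^sub>R w" 1] by simp
    finally show ?thesis using *[of m] by simp
  qed
  moreover obtain m where "2 < real m * norm w"
    using reals_Archimedean3 \<open>w \<noteq> 0\<close> by (metis zero_less_norm_iff)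
  ultimately show False by (meson not_le)
qed

lemma wnorm_mult_le:
  fixes u :: "'a::complex_banach_algebra_1"
  assumes "u \<in> inv_elems"
  shows "wnorm u (x * y) \<le> wnorm u x * wnorm u y"
proof -
  let ?s = "pos_sqrt u" and ?t = "alg_inv (pos_sqrt u)"
  have "?t * (?s * z) = z" for z
    using alg_inv(2)[OF pos_sqrt_invertible[OF assms]] by (metis mult.assoc mult_1_left)
  then have "?s * (x * y) * ?t = (?s * x * ?t) * (?s * y * ?t)"
    by (simp add: mult.assoc)
  then show ?thesis unfolding wnorm_def by (metis norm_mult_ineq)
qed

text \<open>Conjugation by the square root of \<open>u\<close> is an algebra automorphism, so
  \<open>square_zero_eq_0\<close> carries over to the weighted norm.\<close>

lemma wnorm_square_zero_eq_0:
  fixes u :: "'a::complex_banach_algebra_1"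
  assumes u: "u \<in> inv_elems" and n: "n * n = 0" "wnorm u (1 + n) \<le> 1"
  shows "n = 0"
proof -
  let ?s = "pos_sqrt u" and ?t = "alg_inv (pos_sqrt u)"
  have st: "?s * ?t = 1" "?t * ?s = 1"
    using alg_inv[OF pos_sqrt_invertible[OF u]] by simp_all
  have ts: "?t * (?s * z) = z" for z
    using st by (metis mult.assoc mult_1_left)
  have "(?s * n * ?t) * (?s * n * ?t) = ?s * (n * n) * ?t"
    by (simp add: mult.assoc ts)
  then have "(?s * n * ?t) * (?s * n * ?t) = 0" by (simp add: n(1))
  moreover have "1 + ?s * n * ?t = ?s * (1 + n) * ?t"
    by (simp add: algebra_simps st)
  then have "norm (1 + ?s * n * ?t) \<le> 1" using n(2) by (simp only: wnorm_def)
  ultimately have "?s * n * ?t = 0" by (rule square_zero_eq_0)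
  then have "?t * (?s * n * ?t) * ?s = 0" by (simp only: mult_zero_left mult_zero_right)
  then show ?thesis by (simp add: mult.assoc ts st)
qed

lemma double_eq_0: "2 * x = 0 \<Longrightarrow> x = (0 :: 'a::real_normed_algebra_1)"
  by (metis mult_2 scaleR_2 scaleR_eq_0_iff zero_neq_numeral)

text \<open>The hypothesis \<open>qp\<close> says that \<open>q\<close> and \<open>p\<close> have the same range, or that they have the same kernel.
  Either way \<open>n = 2 (p - q)\<close> has square zero and the product of the two reflections is \<open>1 \<plusminus> n\<close>. It has norm at most 1,
  so \<open>n = 0\<close>.\<close>

lemma hermitian_idempotents_eqI:
  fixes p q u :: "'a::complex_banach_algebra_1"
  assumes u: "u \<in> inv_elems"
    and q: "hermitian_in (wnorm u) q" "q * q = q"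
    and p: "hermitian_in (wnorm u) p" "p * p = p"
    and qp: "q * p = p \<and> p * q = q \<or> q * p = q \<and> p * q = p"
  shows "q = p"
proof -
  have *: "wnorm u ((1 - 2 * q) * (1 - 2 * p)) \<le> 1"
    using wnorm_mult_le[OF u] hermitian_idempotent_reflection[OF q]
      hermitian_idempotent_reflection[OF p] by (metis mult_1_left)
  from qp show ?thesis
  proof
    assume qp: "q * p = p \<and> p * q = q"
    have "(1 - 2 * q) * (1 - 2 * p) = 1 + 2 * (p - q)"
      by (simp add: mult_2 algebra_simps p q qp)
    then have "wnorm u (1 + 2 * (p - q)) \<le> 1" using * by simp
    moreover have "2 * (p - q) * (2 * (p - q)) = 0"
      by (simp add: mult_2 algebra_simps p q qp)
    ultimately have "2 * (p - q) = 0" using wnorm_square_zero_eq_0[OF u] by blast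
    then show ?thesis using double_eq_0 by fastforce
  next
    assume qp: "q * p = q \<and> p * q = p"
    have "(1 - 2 * q) * (1 - 2 * p) = 1 + 2 * (q - p)"
      by (simp add: mult_2 algebra_simps p q qp)
    then have "wnorm u (1 + 2 * (q - p)) \<le> 1" using * by simp
    moreover have "2 * (q - p) * (2 * (q - p)) = 0"
      by (simp add: mult_2 algebra_simps p q qp)
    ultimately have "2 * (q - p) = 0" using wnorm_square_zero_eq_0[OF u] by blast
    then show ?thesis using double_eq_0 by fastforce
  qed
qed

text \<open>\<open>a b\<close> and \<open>a c\<close> are hermitian idempotents with range \<open>a A\<close>; \<open>b a\<close> and \<open>c a\<close> are hermitian idempotents
  with the kernel of \<open>a\<close>. So they agree in pairs, and \<open>b = b a b = c a c = c\<close>.\<close>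

lemma is_wmp_inverse_unique:
  fixes a b c e f :: "'a::complex_banach_algebra_1"
  assumes e: "e \<in> inv_elems" and f: "f \<in> inv_elems"
    and b: "is_wmp_inverse e f a b" and c: "is_wmp_inverse e f a c"
  shows "b = c"
proof -
  note d = b[unfolded is_wmp_inverse_def norm_gen_inverse_def] c[unfolded is_wmp_inverse_def norm_gen_inverse_def]
  have b1: "a * (b * (a * x)) = a * x" "b * (a * (b * x)) = b * x" "b * (a * b) = b" "a * (b * a) = a" for x
    using d by (metis mult.assoc)+
  have c1: "a * (c * (a * x)) = a * x" "c * (a * (c * x)) = c * x" "c * (a * c) = c" "a * (c * a) = a" for x
    using d by (metis mult.assoc)+
  have ab: "a * b = a * c"
    by (rule hermitian_idempotents_eqI[OF e]) (use d in \<open>simp_all add: mult.assoc b1 c1\<close>)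
  have ba: "b * a = c * a"
    by (rule hermitian_idempotents_eqI[OF f]) (use d in \<open>simp_all add: mult.assoc b1 c1\<close>)
  show "b = c" by (metis ab ba b1(3) c1(3) mult.assoc)
qed

lemma wmp_eqI:
  fixes a b e f :: "'a::complex_banach_algebra_1"
  assumes "e \<in> inv_elems" "f \<in> inv_elems" "is_wmp_inverse e f a b"
  shows "wmp e f a = b"
  unfolding wmp_def using assms is_wmp_inverse_unique by blast

lemma is_wmp_inverse_wmp:
  fixes a e f :: "'a::complex_banach_algebra_1"
  assumes "e \<in> inv_elems" "f \<in> inv_elems" "wmp_invertible e f a"
  shows "is_wmp_inverse e f a (wmp e f a)"
  using assms wmp_eqI unfolding wmp_invertible_def by metis

lemma is_group_inverse_unique:
  assumes "is_group_inverse a g" "is_group_inverse a h"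
  shows "g = h"
proof -
  interpret group_and_generalized_inverse a h g
    using assms unfolding is_group_inverse_def by unfold_locales metis+
  show ?thesis using commute_iff assms(2) by (simp add: is_group_inverse_def)
qed

lemma group_inverse_eqI: "is_group_inverse a g \<Longrightarrow> group_inverse a = g"
  unfolding group_inverse_def using is_group_inverse_unique by blast

lemma is_wmp_inverse_group_inverse:
  assumes "is_group_inverse a g"
  shows "is_wmp_inverse e f a g \<longleftrightarrow> hermitian_in (wnorm e) (a * g) \<and> hermitian_in (wnorm f) (a * g)"
  using assms by (auto simp: is_wmp_inverse_def norm_gen_inverse_def is_group_inverse_def)

text \<open>A weighted Moore-Penrose inverse that commutes with \<open>a\<close> is a group inverse, hence equals \<open>g\<close>. So being
  weighted EP is a property of the spectral idempotent \<open>a g\<close> and of the two weights separately.\<close>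

lemma weighted_EP_iff_hermitian:
  assumes ef: "e \<in> inv_elems" "f \<in> inv_elems" and g: "is_group_inverse a g"
  shows "weighted_EP e f a \<longleftrightarrow> hermitian_in (wnorm e) (a * g) \<and> hermitian_in (wnorm f) (a * g)"
proof
  assume EP: "weighted_EP e f a"
  let ?c = "wmp e f a"
  have c: "is_wmp_inverse e f a ?c"
    using EP is_wmp_inverse_wmp[OF ef] by (simp add: weighted_EP_def)
  moreover have "is_group_inverse a ?c"
    using EP c by (simp add: weighted_EP_def is_group_inverse_def is_wmp_inverse_def norm_gen_inverse_def)
  ultimately show "hermitian_in (wnorm e) (a * g) \<and> hermitian_in (wnorm f) (a * g)"
    using is_group_inverse_unique[OF g] is_wmp_inverse_group_inverse[OF g] by metis
next
  assume "hermitian_in (wnorm e) (a * g) \<and> hermitian_in (wnorm f) (a * g)"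
  then have w: "is_wmp_inverse e f a g" using is_wmp_inverse_group_inverse[OF g] by blast
  then show "weighted_EP e f a"
    using wmp_eqI[OF ef w] g by (auto simp: weighted_EP_def wmp_invertible_def is_group_inverse_def)
qed

section \<open>The group inverse in the holomorphic functional calculus\<close>

lemma neumann_series:
  fixes x :: "'a::{real_normed_algebra_1,banach}"
  assumes "norm x < 1"
  shows "summable (\<lambda>n. norm (x ^ n))" and "(1 - x) * (\<Sum>n. x ^ n) = 1" and "(\<Sum>n. x ^ n) * (1 - x) = 1"
proof -
  show sn: "summable (\<lambda>n. norm (x ^ n))"
    by (rule summable_comparison_test'[of "\<lambda>n. norm x ^ n" 0])
      (use assms in \<open>simp_all add: norm_power_ineq summable_geometric\<close>)
  then have s: "summable (\<lambda>n. x ^ n)" by (rule summable_norm_cancel)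
  have split: "(\<Sum>n. x ^ n) = 1 + (\<Sum>n. x ^ Suc n)"
    using suminf_split_head[OF s] by simp
  have "(\<Sum>n. x ^ Suc n) = x * (\<Sum>n. x ^ n)" using suminf_mult[OF s, of x] by simp
  with split show "(1 - x) * (\<Sum>n. x ^ n) = 1" by (simp add: algebra_simps)
  have "(\<Sum>n. x ^ Suc n) = (\<Sum>n. x ^ n) * x"
    using suminf_mult2[OF s, of x] by (simp add: power_Suc2 del: power_Suc)
  with split show "(\<Sum>n. x ^ n) * (1 - x) = 1" by (simp add: algebra_simps)
qed

lemma resolvent_large:
  fixes a :: "'a::complex_banach_algebra_1"
  assumes "norm a < cmod z"
  defines "y \<equiv> (\<Sum>n. inverse z ^ Suc n *\<^sub>C a ^ n)"
  shows "(z *\<^sub>C 1 - a) * y = 1" and "y * (z *\<^sub>C 1 - a) = 1"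
proof -
  have z: "z \<noteq> 0" using assms(1) by auto
  define x where "x = inverse z *\<^sub>C a"
  have "norm x < 1" using assms(1) z by (simp add: x_def norm_scaleC norm_inverse norm_divide divide_simps)
  note N = neumann_series[OF this]
  have sx: "summable (\<lambda>n. x ^ n)" using N(1) by (rule summable_norm_cancel)
  have za: "z *\<^sub>C 1 - a = z *\<^sub>C (1 - x)" using z by (simp add: x_def scaleC_simps)
  have "inverse z *\<^sub>C (\<Sum>n. x ^ n) = (\<Sum>n. inverse z *\<^sub>C x ^ n)"
    by (rule bounded_linear.suminf[OF scaleC.bounded_linear_right sx])
  also have "\<dots> = y"
    unfolding y_def x_def by (simp add: scaleC_power scaleC_scaleC)
  finally have y: "y = inverse z *\<^sub>C (\<Sum>n. x ^ n)" by simp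
  show "(z *\<^sub>C 1 - a) * y = 1" "y * (z *\<^sub>C 1 - a) = 1"
    unfolding za y using N z by (simp_all add: mult_scaleC_left mult_scaleC_right scaleC_scaleC)
qed

text \<open>Near 0 the resolvent splits along the idempotent \<open>p = a g\<close>: on the part where \<open>a = 0\<close> it is \<open>z\<^sup>-\<^sup>1\<close>,
  and on \<open>p A p\<close>, where \<open>a\<close> has inverse \<open>g\<close>, it is \<open>- g (1 - z g)\<^sup>-\<^sup>1\<close>. In particular 0 is at most an isolated
  point of the spectrum.\<close>

lemma resolvent_small:
  fixes a g :: "'a::complex_banach_algebra_1"
  assumes g: "is_group_inverse a g" and z: "z \<noteq> 0" "cmod z * norm g < 1"
  defines "y \<equiv> inverse z *\<^sub>C (1 - a * g) - (\<Sum>n. z ^ n *\<^sub>C g ^ Suc n)"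
  shows "(z *\<^sub>C 1 - a) * y = 1" and "y * (z *\<^sub>C 1 - a) = 1"
proof -
  interpret group_and_generalized_inverse a g g
    using g unfolding is_group_inverse_def by unfold_locales metis+
  define x where "x = z *\<^sub>C g"
  define T where "T = (\<Sum>n. x ^ n)"
  have "norm x < 1" using z by (simp add: x_def norm_scaleC)
  note N = neumann_series[OF this, folded T_def]
  have sx: "summable (\<lambda>n. x ^ n)" using N(1) by (rule summable_norm_cancel)
  have "g * T = (\<Sum>n. g * x ^ n)" "T * g = (\<Sum>n. x ^ n * g)"
    unfolding T_def using suminf_mult[OF sx, of g] suminf_mult2[OF sx, of g] by simp_all
  then have gT: "g * T = (\<Sum>n. z ^ n *\<^sub>C g ^ Suc n)" and Tg: "T * g = (\<Sum>n. z ^ n *\<^sub>C g ^ Suc n)"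
    unfolding x_def by (simp_all add: scaleC_power scaleC_simps power_commutes)
  have "(z *\<^sub>C 1 - a) * (inverse z *\<^sub>C (1 - a * g)) = 1 - a * g"
    using z(1) by (simp add: algebra_simps scaleC_simps words)
  moreover have "(z *\<^sub>C 1 - a) * (g * T) = - (a * g * ((1 - x) * T))"
    by (simp add: x_def algebra_simps scaleC_simps words)
  ultimately show "(z *\<^sub>C 1 - a) * y = 1"
    unfolding y_def gT[symmetric] by (simp add: right_diff_distrib N(2))
  have "inverse z *\<^sub>C (1 - a * g) * (z *\<^sub>C 1 - a) = 1 - a * g"
    using z(1) by (simp add: algebra_simps scaleC_simps words)
  moreover have "T * g * (z *\<^sub>C 1 - a) = - (T * (1 - x) * (a * g))"
    by (simp add: x_def algebra_simps scaleC_simps words)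
  ultimately show "y * (z *\<^sub>C 1 - a) = 1"
    unfolding y_def Tg[symmetric] by (simp add: left_diff_distrib N(3))
qed

text \<open>A parameter \<open>s = -1\<close> reverses the orientation, so that both orientations share one computation.\<close>

definition circle :: "real \<Rightarrow> int \<Rightarrow> real \<Rightarrow> complex"
  where "circle r s t = of_real r * exp (of_int s * (2 * of_real pi * \<i> * of_real t))"

lemma circle_eq_circlepath:
  "circle r 1 = circlepath 0 r" "circle r (- 1) = reversepath (circlepath 0 r)"
proof -
  show "circle r 1 = circlepath 0 r"
    by (rule ext) (simp add: circle_def circlepath)
  show "circle r (- 1) = reversepath (circlepath 0 r)"
  proof
    fix t :: real
    have "2 * of_real pi * \<i> * of_real (1 - t) = 2 * of_real pi * \<i> + - (2 * of_real pi * \<i> * of_real t)"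
      by (simp add: algebra_simps)
    then have "exp (2 * of_real pi * \<i> * of_real (1 - t)) = exp (2 * of_real pi * \<i>) * exp (- (2 * of_real pi * \<i> * of_real t))"
      by (simp only: exp_add)
    then show "circle r (- 1) t = reversepath (circlepath 0 r) t"
      by (simp add: circle_def reversepath_def circlepath exp_two_pi_i)
  qed
qed

lemma norm_circle: "0 \<le> r \<Longrightarrow> cmod (circle r s t) = r"
  by (simp add: circle_def norm_mult)

lemma has_vector_derivative_circle:
  "(circle r s has_vector_derivative (of_int s * (2 * of_real pi * \<i>) * circle r s t)) (at t within S)"
  unfolding circle_def
  by (rule has_vector_derivative_real_field) (auto intro!: derivative_eq_intros)

lemma vector_derivative_circle:
  assumes "t \<in> {0..1}"
  shows "vector_derivative (circle r s) (at t within {0..1}) = of_int s * (2 * of_real pi * \<i>) * circle r s t"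
  using vector_derivative_within_cbox[of 0 1 t "circle r s"] has_vector_derivative_circle assms
  by (metis cbox_interval zero_less_one)

text \<open>For \<open>n > 0\<close> the integrand is \<open>exp (c t)\<close> with \<open>c\<close> a nonzero multiple of \<open>2 \<pi> \<i>\<close>, whose primitive
  has period 1.\<close>

lemma integral_circle_power:
  assumes "s = 1 \<or> s = - 1"
  shows "((\<lambda>t. circle 1 s t ^ n) has_integral (if n = 0 then 1 else 0)) {0..1}"
proof (cases "n = 0")
  case True
  then show ?thesis using has_integral_const_real[of "1::complex" 0 1] by simp
next
  case False
  define c where "c = of_nat n * (of_int s * (2 * of_real pi * \<i>) :: complex)"
  have c: "c \<noteq> 0" using False assms by (auto simp: c_def)
  have pow: "circle 1 s t ^ n = exp (c * of_real t)" for t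
    unfolding circle_def c_def by (simp add: algebra_simps flip: exp_of_nat_mult)
  have "((\<lambda>t. exp (c * of_real t)) has_integral (exp (c * of_real 1) / c - exp (c * of_real 0) / c)) {0..1}"
  proof (rule fundamental_theorem_of_calculus)
    fix t :: real
    show "((\<lambda>t. exp (c * of_real t) / c) has_vector_derivative exp (c * of_real t)) (at t within {0..1})"
      by (rule has_vector_derivative_real_field) (use c in \<open>auto intro!: derivative_eq_intros\<close>)
  qed simp
  moreover have "exp c = 1"
    using exp_integer_2pi[of "of_int (int n * s)"] by (simp add: c_def algebra_simps)
  ultimately show ?thesis using False by (simp add: pow)
qed

text \<open>The series converges uniformly in \<open>t\<close>, so it may be integrated term by term. Negative and
  positive powers of the variable are both covered, through the sign of \<open>s\<close>.\<close>

lemma integral_circle_series: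
  fixes c :: "nat \<Rightarrow> 'a::complex_banach_algebra_1"
  assumes s: "s = 1 \<or> s = - 1" and c: "summable (\<lambda>n. norm (c n))"
  shows "((\<lambda>t. \<Sum>n. circle 1 s t ^ n *\<^sub>C c n) has_integral c 0) {0..1}"
proof -
  have u: "uniform_limit {0..1} (\<lambda>N t. \<Sum>n<N. circle 1 s t ^ n *\<^sub>C c n)
      (\<lambda>t. \<Sum>n. circle 1 s t ^ n *\<^sub>C c n) sequentially"
    by (rule Weierstrass_m_test[OF _ c]) (simp add: norm_scaleC norm_power norm_circle)
  have int: "((\<lambda>t. \<Sum>n<N. circle 1 s t ^ n *\<^sub>C c n) has_integral
      (\<Sum>n<N. (if n = 0 then 1 else 0) *\<^sub>C c n)) {0..1}" for N
    by (intro has_integral_sum finite_lessThan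
      has_integral_linear[OF integral_circle_power[OF s] scaleC.bounded_linear_left, unfolded o_def])
  have cont: "continuous_on {0..1} (\<lambda>t. \<Sum>n<N. circle 1 s t ^ n *\<^sub>C c n)" for N
    unfolding circle_def
    by (intro continuous_on_sum bounded_linear.continuous_on[OF scaleC.bounded_linear_left] continuous_intros)
  obtain I J where I: "\<And>N. ((\<lambda>t. \<Sum>n<N. circle 1 s t ^ n *\<^sub>C c n) has_integral I N) {0..1}"
    and J: "((\<lambda>t. \<Sum>n. circle 1 s t ^ n *\<^sub>C c n) has_integral J) {0..1}" and IJ: "I \<longlonglongrightarrow> J"
    using uniform_limit_integral[OF u cont] by auto
  have "I (Suc N) = c 0" for N
  proof -
    have "I (Suc N) = (\<Sum>n<Suc N. (if n = 0 then 1 else 0) *\<^sub>C c n)"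
      using has_integral_unique[OF I int] .
    also have "\<dots> = (\<Sum>n<Suc N. if n = 0 then c n else 0)" by (intro sum.cong) auto
    also have "\<dots> = c 0" by simp
    finally show ?thesis .
  qed
  then have "(\<lambda>N. I (Suc N)) \<longlonglongrightarrow> c 0" by simp
  then have "J = c 0" using IJ LIMSEQ_Suc LIMSEQ_unique by blast
  then show ?thesis using J by simp
qed

lemma spectrum_iff: "z \<notin> spectrum a \<longleftrightarrow> z *\<^sub>C 1 - a \<in> inv_elems"
  by (simp add: spectrum_def)

lemma integral_resolvent_large:
  fixes a :: "'a::complex_banach_algebra_1"
  assumes r: "norm a < r"
  shows "((\<lambda>t. alg_inv (circle r 1 t *\<^sub>C 1 - a)) has_integral 0) {0..1}"
proof -
  have r0: "0 < r" using r norm_ge_zero by (rule le_less_trans[rotated])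
  \<comment> \<open>The shift by one accounts for the factor \<open>z\<^sup>-\<^sup>1\<close> in front of the Neumann series; hence \<open>c 0 = 0\<close>.\<close>
  define c where "c n = (case n of 0 \<Rightarrow> 0 | Suc m \<Rightarrow> complex_of_real (inverse r) ^ n *\<^sub>C a ^ m)" for n
  have "norm (inverse r *\<^sub>R a) < 1" using r r0 by (simp add: divide_simps)
  from neumann_series(1)[OF this]
  have "summable (\<lambda>m. inverse r * norm ((inverse r *\<^sub>R a) ^ m))" by (rule summable_mult)
  then have "summable (\<lambda>m. norm (c (Suc m)))"
    using r0 by (simp add: c_def norm_scaleC norm_mult norm_power norm_inverse power_inverse mult.assoc)
  then have c: "summable (\<lambda>n. norm (c n))" by (subst (asm) summable_Suc_iff)
  have "((\<lambda>t. \<Sum>n. circle 1 (- 1) t ^ n *\<^sub>C c n) has_integral c 0) {0..1}"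
    by (rule integral_circle_series[OF _ c]) simp
  moreover have "(\<Sum>n. circle 1 (- 1) t ^ n *\<^sub>C c n) = alg_inv (circle r 1 t *\<^sub>C 1 - a)" for t
  proof -
    let ?z = "circle r 1 t"
    have inv: "inverse ?z = circle 1 (- 1) t * of_real (inverse r)"
      by (simp add: circle_def exp_minus)
    have "summable (\<lambda>n. norm (circle 1 (- 1) t ^ n *\<^sub>C c n))"
      using c by (simp add: norm_scaleC norm_power norm_circle)
    then have "(\<Sum>n. circle 1 (- 1) t ^ n *\<^sub>C c n) = (\<Sum>n. circle 1 (- 1) t ^ Suc n *\<^sub>C c (Suc n))"
      using suminf_split_head[OF summable_norm_cancel] by (fastforce simp: c_def)
    also have "\<dots> = (\<Sum>n. inverse ?z ^ Suc n *\<^sub>C a ^ n)"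
      unfolding inv c_def by (simp add: scaleC_scaleC power_mult_distrib mult_ac)
    also have "\<dots> = alg_inv (?z *\<^sub>C 1 - a)"
      by (rule alg_inv_eqI[symmetric])
        (use resolvent_large[of a ?z] r r0 in \<open>simp_all add: norm_circle\<close>)
    finally show ?thesis .
  qed
  ultimately show ?thesis by (simp add: c_def)
qed

lemma integral_resolvent_small:
  fixes a g :: "'a::complex_banach_algebra_1"
  assumes g: "is_group_inverse a g" and r: "0 < r" "r * norm g < 1"
  shows "((\<lambda>t. alg_inv (circle r (- 1) t *\<^sub>C 1 - a)) has_integral - g) {0..1}"
proof -
  define c where "c n = complex_of_real r ^ n *\<^sub>C g ^ Suc n" for n
  \<comment> \<open>The polar part \<open>z\<^sup>-\<^sup>1 (1 - a g)\<close>, as a series in \<open>z\<^sup>-\<^sup>1\<close> with a single term.\<close>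
  define d where "d n = (if n = 1 then complex_of_real (inverse r) *\<^sub>C (1 - a * g) else 0)" for n :: nat
  have "norm (r *\<^sub>R g) < 1" using r by simp
  from neumann_series(1)[OF this]
  have s: "summable (\<lambda>m. norm ((r *\<^sub>R g) ^ m) * norm g)" by (rule summable_mult2)
  have c: "summable (\<lambda>n. norm (c n))"
  proof (rule summable_comparison_test'[OF s])
    fix n
    have "norm (g ^ Suc n) \<le> norm (g ^ n) * norm g"
      by (metis norm_mult_ineq power_Suc2)
    then show "norm (norm (c n)) \<le> norm ((r *\<^sub>R g) ^ n) * norm g"
      using r(1) by (simp add: c_def norm_scaleC norm_power mult.assoc mult_left_mono del: power_Suc)
  qed
  have d: "summable (\<lambda>n. norm (d n))"
    by (rule summable_finite[of "{1}"]) (auto simp: d_def)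
  have "((\<lambda>t. (\<Sum>n. circle 1 1 t ^ n *\<^sub>C d n) - (\<Sum>n. circle 1 (- 1) t ^ n *\<^sub>C c n))
      has_integral d 0 - c 0) {0..1}"
    by (intro has_integral_diff integral_circle_series c d) simp_all
  moreover have "(\<Sum>n. circle 1 1 t ^ n *\<^sub>C d n) - (\<Sum>n. circle 1 (- 1) t ^ n *\<^sub>C c n)
      = alg_inv (circle r (- 1) t *\<^sub>C 1 - a)" for t
  proof -
    let ?z = "circle r (- 1) t"
    have z: "?z = circle 1 (- 1) t * of_real r" and inv: "inverse ?z = circle 1 1 t * of_real (inverse r)"
      by (simp_all add: circle_def exp_minus)
    have "(\<Sum>n. circle 1 1 t ^ n *\<^sub>C d n) = inverse ?z *\<^sub>C (1 - a * g)"
      by (subst suminf_finite[of "{1}"]) (auto simp: d_def inv scaleC_scaleC)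
    moreover have "(\<Sum>n. circle 1 (- 1) t ^ n *\<^sub>C c n) = (\<Sum>n. ?z ^ n *\<^sub>C g ^ Suc n)"
      unfolding z c_def by (simp add: scaleC_scaleC power_mult_distrib del: power_Suc)
    moreover have "alg_inv (?z *\<^sub>C 1 - a) = inverse ?z *\<^sub>C (1 - a * g) - (\<Sum>n. ?z ^ n *\<^sub>C g ^ Suc n)"
    proof (rule alg_inv_eqI)
      have "cmod ?z = r" using r by (simp add: norm_circle)
      moreover from this have "?z \<noteq> 0" using r by auto
      ultimately show "(?z *\<^sub>C 1 - a) * (inverse ?z *\<^sub>C (1 - a * g) - (\<Sum>n. ?z ^ n *\<^sub>C g ^ Suc n)) = 1"
        "(inverse ?z *\<^sub>C (1 - a * g) - (\<Sum>n. ?z ^ n *\<^sub>C g ^ Suc n)) * (?z *\<^sub>C 1 - a) = 1"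
        using resolvent_small[OF g, of ?z] r by auto
    qed
    ultimately show ?thesis by simp
  qed
  ultimately show ?thesis by (simp add: c_def d_def)
qed

text \<open>On a circle the factor \<open>h(z) dz = z\<^sup>-\<^sup>1 dz\<close> is constant in the parameter, so only the mean of the
  resolvent over the circle matters.\<close>

lemma resolvent_integral_inverse_circle:
  fixes a x :: "'a::complex_banach_algebra_1"
  assumes r: "0 < r" and h: "\<And>z. cmod z = r \<Longrightarrow> h z = inverse z"
    and I: "((\<lambda>t. alg_inv (circle r s t *\<^sub>C 1 - a)) has_integral x) {0..1}"
  shows "resolvent_integral h a (circle r s) = (of_int s * (2 * of_real pi * \<i>)) *\<^sub>C x"
proof -
  let ?k = "of_int s * (2 * of_real pi * \<i>) :: complex"
  have "((\<lambda>t. ?k *\<^sub>C alg_inv (circle r s t *\<^sub>C 1 - a)) has_integral ?k *\<^sub>C x) {0..1}"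
    using has_integral_linear[OF I scaleC.bounded_linear_right] by (simp add: o_def)
  moreover have "?k *\<^sub>C alg_inv (circle r s t *\<^sub>C 1 - a) =
      (h (circle r s t) * vector_derivative (circle r s) (at t within {0..1})) *\<^sub>C
        alg_inv (circle r s t *\<^sub>C 1 - a)" if "t \<in> {0..1}" for t
  proof -
    have "cmod (circle r s t) = r" using r by (simp add: norm_circle)
    moreover from this have "circle r s t \<noteq> 0" using r by auto
    then have "inverse (circle r s t) * (?k * circle r s t) = ?k" by (simp add: field_simps)
    ultimately show ?thesis using that by (simp only: h vector_derivative_circle)
  qed
  ultimately show ?thesis
    unfolding resolvent_integral_def by (metis (no_types, lifting) has_integral_eq integral_unique)
qed

lemma winding_number_circlepath_outside:
  assumes "0 < r" "r < cmod z"
  shows "winding_number (circlepath 0 r) z = 0"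
  by (rule winding_number_zero_outside[of _ "cball 0 r"]) (use assms in auto)

lemma winding_number_circlepath_inside:
  assumes "cmod z < r"
  shows "winding_number (circlepath 0 r) z = 1"
  using assms by (intro winding_number_circlepath) simp

text \<open>\<open>h\<close> is 0 near 0 and \<open>z\<^sup>-\<^sup>1\<close> elsewhere. Besides possibly 0, the spectrum lies in
  \<open>d \<le> \<bar>z\<bar> < R\<close>; a large circle, a reversed circle of radius below \<open>d\<close>, and a small circle around 0 form a
  cycle as required. The large circle contributes 0 since the resolvent has no constant Laurent coefficient there,
  the reversed one contributes \<open>g\<close>, and on the small one \<open>h\<close> vanishes.\<close>

lemma group_inverse_hol_calc:
  fixes a g :: "'a::complex_banach_algebra_1"
  assumes g: "is_group_inverse a g"
  shows "\<exists>U h. open U \<and> spectrum a \<subseteq> U \<and> h holomorphic_on U \<and> is_hol_calc U h a g"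
proof -
  \<comment> \<open>The added 1 covers \<open>g = 0\<close>.\<close>
  define d where "d = inverse (norm g + 1)"
  have d: "0 < d" "d * norm g < 1" "d \<le> 1"
    by (simp_all add: d_def divide_simps add_pos_nonneg add_nonneg_pos)
  define R where "R = norm a + 1"
  have R: "norm a < R" "1 \<le> R" by (simp_all add: R_def)
  \<comment> \<open>The small circles have radii \<open>r1\<close> and \<open>r4\<close>; between them, the closed annulus from \<open>r2\<close> to \<open>r3\<close> is left out of \<open>U\<close>.\<close>
  define r1 r2 r3 r4 where r: "r1 = d / 5" "r2 = 2 * d / 5" "r3 = 3 * d / 5" "r4 = 4 * d / 5"
  have ord: "0 < r1" "r1 < r2" "r2 < r3" "r3 < r4" "r4 < d" "r4 < R"
    using d R by (simp_all add: r)
  have spec_R: "cmod z < R" if "z \<in> spectrum a" for z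
  proof (rule ccontr)
    assume "\<not> cmod z < R"
    then have "norm a < cmod z" using R by simp
    from resolvent_large[OF this] have "z \<notin> spectrum a"
      unfolding spectrum_iff inv_elems_def by blast
    then show False using that by simp
  qed
  have spec_d: "z = 0 \<or> d \<le> cmod z" if "z \<in> spectrum a" for z
  proof (rule ccontr)
    assume *: "\<not> (z = 0 \<or> d \<le> cmod z)"
    then have "cmod z * norm g < 1"
      using d by (meson le_less_trans mult_right_mono less_imp_le norm_ge_zero not_le)
    with * resolvent_small[OF g, of z] have "z \<notin> spectrum a"
      unfolding spectrum_iff inv_elems_def by blast
    then show False using that by simp
  qed
  define U where "U = ball (0::complex) r2 \<union> - cball 0 r3"
  define h where "h z = (if cmod z < r2 then 0 else inverse z)" for z :: complex
  have hol: "h holomorphic_on U"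
    unfolding U_def
  proof (rule holomorphic_on_Un)
    show "h holomorphic_on ball 0 r2"
      by (rule holomorphic_transform[of "\<lambda>_. 0"]) (auto simp: h_def)
    have "inverse holomorphic_on - cball 0 r3"
      using ord by (auto intro!: holomorphic_intros)
    then show "h holomorphic_on - cball 0 r3"
      by (rule holomorphic_transform) (use ord in \<open>auto simp: h_def\<close>)
  qed auto
  define \<Gamma> where "\<Gamma> = [circlepath 0 R, reversepath (circlepath 0 r4), circlepath 0 r1]"
  have "cycle_around (spectrum a) U \<Gamma>"
    unfolding cycle_around_def
  proof (intro conjI ballI allI impI)
    fix \<gamma> assume \<gamma>: "\<gamma> \<in> set \<Gamma>"
    then show "valid_path \<gamma>" "pathfinish \<gamma> = pathstart \<gamma>" by (auto simp: \<Gamma>_def)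
    show "path_image \<gamma> \<subseteq> U - spectrum a"
    proof
      fix z assume "z \<in> path_image \<gamma>"
      then have "cmod z = R \<or> cmod z = r4 \<or> cmod z = r1"
        using \<gamma> ord by (auto simp: \<Gamma>_def)
      then show "z \<in> U - spectrum a"
        using ord spec_R[of z] spec_d[of z] by (auto simp: U_def)
    qed
  next
    fix z assume "z \<in> spectrum a"
    from spec_d[OF this] spec_R[OF this]
    have "(z = 0 \<or> r4 < cmod z) \<and> cmod z < R" using ord by auto
    then show "(\<Sum>\<gamma>\<leftarrow>\<Gamma>. winding_number \<gamma> z) = 1"
      using ord
      by (auto simp: \<Gamma>_def winding_number_reversepath winding_number_circlepath_inside
          winding_number_circlepath_outside)
  next
    fix z assume "z \<notin> U"
    then have "r2 \<le> cmod z" "cmod z \<le> r3" by (auto simp: U_def)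
    then show "(\<Sum>\<gamma>\<leftarrow>\<Gamma>. winding_number \<gamma> z) = 0"
      using ord
      by (auto simp: \<Gamma>_def winding_number_reversepath winding_number_circlepath_inside
          winding_number_circlepath_outside)
  qed
  moreover have "(\<Sum>\<gamma>\<leftarrow>\<Gamma>. resolvent_integral h a \<gamma>) = (2 * of_real pi * \<i>) *\<^sub>C g"
  proof -
    have 1: "resolvent_integral h a (circlepath 0 R) = 0"
      using resolvent_integral_inverse_circle[OF _ _ integral_resolvent_large[OF R(1)], of h] ord
      by (simp add: h_def circle_eq_circlepath scaleC.zero_right)
    have "r4 * norm g < 1" using d ord
      by (meson le_less_trans mult_right_mono less_imp_le norm_ge_zero)
    then have 2: "resolvent_integral h a (reversepath (circlepath 0 r4)) = (2 * of_real pi * \<i>) *\<^sub>C g"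
      using resolvent_integral_inverse_circle[OF _ _ integral_resolvent_small[OF g, of r4], of h] ord
      by (simp add: h_def circle_eq_circlepath scaleC.minus_left scaleC.minus_right)
    have "h (circlepath 0 r1 t) = 0" for t
    proof -
      have "cmod (circlepath 0 r1 t) = r1"
        using norm_circle[of r1 1 t] ord by (simp add: circle_eq_circlepath)
      then show ?thesis using ord by (simp add: h_def)
    qed
    then have 3: "resolvent_integral h a (circlepath 0 r1) = 0"
      by (simp add: resolvent_integral_def scaleC.zero_left)
    show ?thesis by (simp add: \<Gamma>_def 1 2 3)
  qed
  ultimately have "is_hol_calc U h a g"
    unfolding is_hol_calc_def by (intro exI[of _ \<Gamma>]) (simp add: scaleC_scaleC)
  moreover have "open U" by (auto simp: U_def)
  moreover have "spectrum a \<subseteq> U"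
    using spec_d ord by (force simp: U_def)
  ultimately show ?thesis using hol by blast
qed

lemma alg_inv_commute:
  fixes x y :: "'a::complex_banach_algebra_1"
  assumes "x \<in> inv_elems" "x * y = y * x"
  shows "alg_inv x * y = y * alg_inv x"
  using alg_inv[OF assms(1)] assms(2) by (metis mult.assoc mult_1_left mult_1_right)

text \<open>The resolvent at each point of the cycle commutes with \<open>a\<close>, and multiplication by \<open>a\<close> can be moved through
  the integral.\<close>

lemma hol_calc_commute:
  fixes a b :: "'a::complex_banach_algebra_1"
  assumes "is_hol_calc U h a b"
  shows "a * b = b * a"
proof -
  obtain \<Gamma> where \<Gamma>: "cycle_around (spectrum a) U \<Gamma>"
    and b: "b = (1 / (2 * complex_of_real pi * \<i>)) *\<^sub>C (\<Sum>\<gamma>\<leftarrow>\<Gamma>. resolvent_integral h a \<gamma>)"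
    using assms by (auto simp: is_hol_calc_def)
  have *: "a * resolvent_integral h a \<gamma> = resolvent_integral h a \<gamma> * a" if \<gamma>: "\<gamma> \<in> set \<Gamma>" for \<gamma>
  proof -
    define F where "F = (\<lambda>t. (h (\<gamma> t) * vector_derivative \<gamma> (at t within {0..1})) *\<^sub>C
      alg_inv (\<gamma> t *\<^sub>C 1 - a))"
    have aF: "a * F t = F t * a" if "t \<in> {0..1}" for t
    proof -
      have "\<gamma> t \<in> path_image \<gamma>" using that by (auto simp: path_image_def)
      then have "\<gamma> t *\<^sub>C 1 - a \<in> inv_elems"
        using \<Gamma> \<gamma> by (auto simp: cycle_around_def spectrum_def)
      then show ?thesis
        unfolding F_def using alg_inv_commute[of "\<gamma> t *\<^sub>C 1 - a" a]
        by (simp add: scaleC_simps algebra_simps)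
    qed
    show ?thesis
    proof (cases "F integrable_on {0..1}")
      case True
      then have I: "(F has_integral integral {0..1} F) {0..1}" by (rule integrable_integral)
      have "((\<lambda>t. a * F t) has_integral a * integral {0..1} F) {0..1}"
        "((\<lambda>t. F t * a) has_integral integral {0..1} F * a) {0..1}"
        using has_integral_mult_right[OF I] has_integral_mult_left[OF I] by blast+
      then have "a * integral {0..1} F = integral {0..1} F * a"
        using aF by (metis (no_types, lifting) has_integral_eq has_integral_unique)
      then show ?thesis by (simp add: resolvent_integral_def F_def)
    next
      case False
      \<comment> \<open>The integral of a non-integrable function is 0 by convention, which commutes with \<open>a\<close> as well.\<close>
      then have "integral {0..1} F = 0" by (rule not_integrable_integral)
      then show ?thesis by (simp add: resolvent_integral_def F_def)
    qed
  qed
  have "a * (\<Sum>\<gamma>\<leftarrow>\<Delta>. resolvent_integral h a \<gamma>) = (\<Sum>\<gamma>\<leftarrow>\<Delta>. resolvent_integral h a \<gamma>) * a"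
    if "set \<Delta> \<subseteq> set \<Gamma>" for \<Delta>
    using that by (induction \<Delta>) (simp_all add: * distrib_left distrib_right)
  then show ?thesis unfolding b by (simp add: scaleC_simps)
qed

section \<open>Ideals, units and linear combinations\<close>

lemma right_ideal_subset_iff:
  "right_ideal x \<subseteq> right_ideal y \<longleftrightarrow> (\<exists>z. x = y * z)"
proof
  assume "right_ideal x \<subseteq> right_ideal y"
  moreover have "x * 1 \<in> right_ideal x" unfolding right_ideal_def by blast
  ultimately show "\<exists>z. x = y * z" by (auto simp: right_ideal_def)
next
  assume "\<exists>z. x = y * z"
  then show "right_ideal x \<subseteq> right_ideal y" by (auto simp: right_ideal_def mult.assoc)
qed

lemma null_space_subsetI: "x = z * y \<Longrightarrow> null_space y \<subseteq> null_space x"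
  by (auto simp: null_space_def mult.assoc)

locale group_and_generalized_inverse_banach = group_and_generalized_inverse a b g
  for a b g :: "'a::complex_banach_algebra_1"
begin

text \<open>\<open>b A = r A\<close> and \<open>a A = p A\<close>. Since \<open>p r = p\<close> and \<open>r p = r\<close>, either inclusion between the two forces
  \<open>r = p\<close>; this is why the four mixed inclusions are all equivalent.\<close>

lemma range_subset_iff:
  "right_ideal b \<subseteq> right_ideal a \<longleftrightarrow> b * a = a * g"
  "right_ideal a \<subseteq> right_ideal b \<longleftrightarrow> b * a = a * g"
proof -
  show "right_ideal b \<subseteq> right_ideal a \<longleftrightarrow> b * a = a * g"
    unfolding right_ideal_subset_iff
  proof
    assume "\<exists>z. b = a * z"
    then have "a * (g * b) = b" by (auto simp: words)
    from arg_cong[OF this, of "\<lambda>x. x * a"] show "b * a = a * g" by (simp add: words)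
  next
    assume "b * a = a * g"
    then have "b * a * b = a * (g * b)" by (simp add: mult.assoc)
    then show "\<exists>z. b = a * z" unfolding bab by blast
  qed
  show "right_ideal a \<subseteq> right_ideal b \<longleftrightarrow> b * a = a * g"
    unfolding right_ideal_subset_iff ba_eq_iff[symmetric]
  proof
    assume "\<exists>z. a = b * z"
    then obtain z where z: "a = b * z" by blast
    have "b * (a * (b * z)) = b * z" by (simp add: words)
    then show "b * a * a = a" unfolding mult.assoc z[symmetric] .
  next
    assume "b * a * a = a"
    then show "\<exists>z. a = b * z" by (metis mult.assoc)
  qed
qed

text \<open>\<open>1 - p\<close> lies in the null space of \<open>a\<close> and \<open>1 - q\<close> in that of \<open>b\<close>; testing the inclusions on these
  two elements yields \<open>q = p\<close>.\<close>

lemma kernel_subset_iff: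
  "null_space a \<subseteq> null_space b \<longleftrightarrow> a * b = a * g"
  "null_space b \<subseteq> null_space a \<longleftrightarrow> a * b = a * g"
proof -
  show "null_space a \<subseteq> null_space b \<longleftrightarrow> a * b = a * g"
  proof
    assume *: "null_space a \<subseteq> null_space b"
    have "1 - a * g \<in> null_space a" by (simp add: null_space_def right_diff_distrib words)
    with * have "b * (1 - a * g) = 0" by (auto simp: null_space_def)
    from arg_cong[OF this, of "\<lambda>x. a * x"] show "a * b = a * g"
      by (simp add: right_diff_distrib words)
  next
    assume "a * b = a * g"
    then have "b = (b * g) * a" by (metis bab ag_commute mult.assoc)
    then show "null_space a \<subseteq> null_space b" by (rule null_space_subsetI)
  qed
  show "null_space b \<subseteq> null_space a \<longleftrightarrow> a * b = a * g"
  proof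
    assume *: "null_space b \<subseteq> null_space a"
    have "1 - a * b \<in> null_space b" by (simp add: null_space_def right_diff_distrib words)
    with * have "a * (1 - a * b) = 0" by (auto simp: null_space_def)
    then show "a * b = a * g"
      unfolding ab_eq_iff[symmetric] by (simp add: right_diff_distrib mult.assoc)
  next
    assume "a * b = a * g"
    then have "a = (a * a) * b" using ab_eq_iff by metis
    then show "null_space b \<subseteq> null_space a" by (rule null_space_subsetI)
  qed
qed

lemma range_kernel_eq_iff: "right_ideal b = right_ideal a \<and> null_space b = null_space a \<longleftrightarrow> b = g"
  unfolding set_eq_subset[of "right_ideal b"] set_eq_subset[of "null_space b"]
    range_subset_iff kernel_subset_iff eq_group_inverse_iff[symmetric] by blast

lemma range_kernel_inclusion_iff:
  "right_ideal b \<subseteq> right_ideal a \<and> null_space a \<subseteq> null_space b \<longleftrightarrow> b = g"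
  "right_ideal a \<subseteq> right_ideal b \<and> null_space a \<subseteq> null_space b \<longleftrightarrow> b = g"
  "right_ideal b \<subseteq> right_ideal a \<and> null_space b \<subseteq> null_space a \<longleftrightarrow> b = g"
  "right_ideal a \<subseteq> right_ideal b \<and> null_space b \<subseteq> null_space a \<longleftrightarrow> b = g"
  unfolding range_subset_iff kernel_subset_iff eq_group_inverse_iff by (rule refl)+

lemma mem_ideals_iff: "a \<in> right_ideal b \<inter> left_ideal b \<longleftrightarrow> b = g"
proof
  assume "a \<in> right_ideal b \<inter> left_ideal b"
  then obtain x y where x: "a = b * x" and y: "a = y * b"
    unfolding right_ideal_def left_ideal_def by blast
  have "right_ideal a \<subseteq> right_ideal b" using x right_ideal_subset_iff by blast
  moreover have "null_space b \<subseteq> null_space a" using y by (rule null_space_subsetI)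
  ultimately show "b = g" using range_kernel_inclusion_iff(4) by blast
next
  assume "b = g"
  have "a = g * (a * a)" "a = (a * a) * g" by (simp_all add: words)
  then show "a \<in> right_ideal b \<inter> left_ideal b"
    unfolding \<open>b = g\<close> right_ideal_def left_ideal_def by blast
qed

text \<open>\<open>a\<^sup>2\<close> is invertible in \<open>p A p\<close>, with inverse \<open>g\<^sup>2\<close>; adding \<open>1 - p\<close> makes it a unit of \<open>A\<close>.\<close>

lemma unit_factor:
  "a * a + (1 - a * g) \<in> inv_elems" "g * (a * a + (1 - a * g)) = a" "(a * a + (1 - a * g)) * g = a"
proof -
  have "(a * a + (1 - a * g)) * (g * g + (1 - a * g)) = 1"
    "(g * g + (1 - a * g)) * (a * a + (1 - a * g)) = 1"
    by (simp_all add: algebra_simps word_simps)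
  then show "a * a + (1 - a * g) \<in> inv_elems" unfolding inv_elems_def by blast
  show "g * (a * a + (1 - a * g)) = a" "(a * a + (1 - a * g)) * g = a"
    by (simp_all add: algebra_simps word_simps)
qed

lemma unit_multiple_iff: "a \<in> (\<lambda>y. b * y) ` inv_elems \<inter> (\<lambda>y. y * b) ` inv_elems \<longleftrightarrow> b = g"
proof
  assume "a \<in> (\<lambda>y. b * y) ` inv_elems \<inter> (\<lambda>y. y * b) ` inv_elems"
  then have "a \<in> right_ideal b \<inter> left_ideal b"
    by (auto simp: right_ideal_def left_ideal_def)
  then show "b = g" using mem_ideals_iff by blast
next
  assume "b = g"
  then show "a \<in> (\<lambda>y. b * y) ` inv_elems \<inter> (\<lambda>y. y * b) ` inv_elems"
    using unit_factor by (metis IntI image_eqI)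
qed

lemma one_sided_unit_multiple_iff:
  "(\<exists>u v. a = b * u \<and> a = v * b \<and> right_ideal u = UNIV \<and> null_space v = {0}) \<longleftrightarrow> b = g"
proof
  assume "\<exists>u v. a = b * u \<and> a = v * b \<and> right_ideal u = UNIV \<and> null_space v = {0}"
  then have "a \<in> right_ideal b \<inter> left_ideal b"
    by (auto simp: right_ideal_def left_ideal_def)
  then show "b = g" using mem_ideals_iff by blast
next
  assume "b = g"
  let ?u = "a * a + (1 - a * g)"
  obtain w where w: "?u * w = 1" "w * ?u = 1"
    using unit_factor(1) unfolding inv_elems_def by blast
  have "y = ?u * (w * y)" for y using w by (metis mult.assoc mult_1_left)
  then have "right_ideal ?u = UNIV" unfolding right_ideal_def by blast
  moreover have "y = 0" if "?u * y = 0" for y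
    using w that by (metis mult.assoc mult_1_left mult_zero_right)
  then have "null_space ?u = {0}" unfolding null_space_def by auto
  ultimately show "\<exists>u v. a = b * u \<and> a = v * b \<and> right_ideal u = UNIV \<and> null_space v = {0}"
    using unit_factor \<open>b = g\<close> by metis
qed

lemma hol_calc_iff:
  "(\<exists>U h. open U \<and> spectrum a \<subseteq> U \<and> h holomorphic_on U \<and> is_hol_calc U h a b) \<longleftrightarrow> b = g"
proof
  assume "\<exists>U h. open U \<and> spectrum a \<subseteq> U \<and> h holomorphic_on U \<and> is_hol_calc U h a b"
  then show "b = g" using hol_calc_commute commute_iff by blast
next
  assume "b = g"
  then show "\<exists>U h. open U \<and> spectrum a \<subseteq> U \<and> h holomorphic_on U \<and> is_hol_calc U h a b"
    using group_inverse_hol_calc aga gag ag_commute unfolding is_group_inverse_def by blast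
qed

context
  fixes lam :: complex
  assumes lam: "lam \<noteq> 0"
begin

text \<open>The equation reads \<open>x + \<lambda> q b = x q + \<lambda> b\<close> with \<open>x = a\<^sup>k\<close>. Right multiplication by \<open>p\<close> removes \<open>x\<close>
  and leaves \<open>q b p = b p\<close>, which gives \<open>r = p\<close>; then \<open>q b = b\<close>, so what remains is \<open>x = x q\<close>, and \<open>q = p\<close>.\<close>

lemma range_projection_pencil_iff:
  assumes k: "k \<ge> 1"
  shows "a * b * (a^k + lam *\<^sub>C b) = (a^k + lam *\<^sub>C b) * a * b \<longleftrightarrow> b = g"
proof
  assume *: "a * b * (a^k + lam *\<^sub>C b) = (a^k + lam *\<^sub>C b) * a * b"
  then have eq: "a^k + lam *\<^sub>C (a * (b * b)) = a^k * (a * b) + lam *\<^sub>C b"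
    by (simp add: distrib_left distrib_right scaleC_simps pow_words[OF k] words)
  from arg_cong[OF this, of "\<lambda>x. x * (a * g)"]
  have "lam *\<^sub>C (a * (b * (b * (a * g)))) = lam *\<^sub>C (b * (a * g))"
    by (simp add: distrib_right scaleC_simps pow_words[OF k] words)
  then have "a * (b * (b * (a * g))) = b * (a * g)" using scaleC_cancel[OF lam] by blast
  from arg_cong[OF this, of "\<lambda>x. x * a"] have "a * b * b * a = b * a"
    by (simp add: words)
  then have ba: "b * a = a * g" by (rule ba_eqI)
  have "a * (b * b) = a * b * (b * a * b)" by (simp add: words)
  also have "\<dots> = b * a * b" unfolding ba by (simp add: words)
  finally have "a * (b * b) = b" by (simp only: bab)
  with eq have "a^k * (a * b) = a^k" by simp
  then have "a * a * b = a" using kernel_condition pow_words(2)[OF k] by blast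
  then show "b = g" using ba eq_group_inverse_iff ab_eq_iff by blast
next
  assume "b = g"
  show "a * b * (a^k + lam *\<^sub>C b) = (a^k + lam *\<^sub>C b) * a * b"
    unfolding \<open>b = g\<close> by (simp add: distrib_left distrib_right scaleC_simps pow_words[OF k] words)
qed

text \<open>Now \<open>r x + \<lambda> b = x + \<lambda> b r\<close>, and left multiplication by \<open>p\<close> plays the same role.\<close>

lemma kernel_projection_pencil_iff:
  assumes k: "k \<ge> 1"
  shows "b * a * (a^k + lam *\<^sub>C b) = (a^k + lam *\<^sub>C b) * b * a \<longleftrightarrow> b = g"
proof
  assume *: "b * a * (a^k + lam *\<^sub>C b) = (a^k + lam *\<^sub>C b) * b * a"
  then have eq: "b * (a * a^k) + lam *\<^sub>C b = a^k + lam *\<^sub>C (b * (b * a))"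
    by (simp add: distrib_left distrib_right scaleC_simps pow_words[OF k] words)
  from arg_cong[OF this, of "\<lambda>x. a * g * x"]
  have "lam *\<^sub>C (a * (g * b)) = lam *\<^sub>C (a * (g * (b * (b * a))))"
    by (simp add: distrib_left scaleC_simps pow_words[OF k] words)
  then have "a * (g * b) = a * (g * (b * (b * a)))" using scaleC_cancel[OF lam] by blast
  from arg_cong[OF this, of "\<lambda>x. a * x"] have "a * b = a * (b * (b * a))"
    by (simp add: words)
  then have "a * b * b * a = a * b" unfolding mult.assoc by (rule sym)
  then have ab: "a * b = a * g" by (rule ab_eqI)
  have "b * (b * a) = b * (a * b) * (b * a)" by (simp add: words)
  also have "\<dots> = b * (a * b)" unfolding ab by (simp add: words)
  finally have "b * (b * a) = b" by (simp add: words)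
  with eq have "b * a * a^k = a^k" by (simp add: mult.assoc)
  then have "b * a * a = a" using range_condition pow_words(1)[OF k] by blast
  then show "b = g" using ab eq_group_inverse_iff ba_eq_iff by blast
next
  assume "b = g"
  show "b * a * (a^k + lam *\<^sub>C b) = (a^k + lam *\<^sub>C b) * b * a"
    unfolding \<open>b = g\<close> by (simp add: distrib_left distrib_right scaleC_simps pow_words[OF k] words)
qed

text \<open>If the right ideals agree, then \<open>a + \<lambda> b\<close> lies in \<open>a A\<close>, hence so does \<open>b\<close>; if the null spaces agree,
  then \<open>a + \<lambda> b\<close> and hence \<open>b\<close> annihilate \<open>1 - p\<close>. Conversely \<open>a + \<lambda> g\<close> and \<open>\<lambda> a + a\<^sup>3\<close> differ by the factors
  \<open>g\<^sup>2\<close> and \<open>a\<^sup>2\<close>, on either side.\<close>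

lemma pencil_ideals_iff:
  "right_ideal (a + lam *\<^sub>C b) = right_ideal (lam *\<^sub>C a + a^3) \<and>
   null_space (a + lam *\<^sub>C b) = null_space (lam *\<^sub>C a + a^3) \<longleftrightarrow> b = g"
proof
  assume *: "right_ideal (a + lam *\<^sub>C b) = right_ideal (lam *\<^sub>C a + a^3) \<and>
   null_space (a + lam *\<^sub>C b) = null_space (lam *\<^sub>C a + a^3)"
  then obtain z where z: "a + lam *\<^sub>C b = (lam *\<^sub>C a + a^3) * z"
    using right_ideal_subset_iff by blast
  have "a * g * (a + lam *\<^sub>C b) = a + lam *\<^sub>C b"
    unfolding z by (simp add: distrib_left distrib_right scaleC_simps words power3_eq_cube)
  then have "lam *\<^sub>C (a * (g * b)) = lam *\<^sub>C b"
    by (simp add: distrib_left scaleC_simps words)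
  then have "a * (g * b) = b" using scaleC_cancel[OF lam] by blast
  from arg_cong[OF this, of "\<lambda>x. x * a"] have 1: "b * a = a * g" by (simp add: words)
  have "(lam *\<^sub>C a + a^3) * (1 - a * g) = 0"
    by (simp add: distrib_right right_diff_distrib scaleC_simps words power3_eq_cube)
  with * have "(a + lam *\<^sub>C b) * (1 - a * g) = 0" unfolding null_space_def by blast
  then have "lam *\<^sub>C (b * (1 - a * g)) = lam *\<^sub>C 0"
    by (simp add: distrib_right right_diff_distrib scaleC_simps words)
  then have "b * (1 - a * g) = 0" using scaleC_cancel[OF lam] by blast
  from arg_cong[OF this, of "\<lambda>x. a * x"] have 2: "a * b = a * g"
    by (simp add: right_diff_distrib words)
  from 1 2 show "b = g" by (rule eq_group_inverseI')
next
  assume "b = g"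
  have "a + lam *\<^sub>C g = (lam *\<^sub>C a + a^3) * (g * g)" "lam *\<^sub>C a + a^3 = (a + lam *\<^sub>C g) * (a * a)"
    "a + lam *\<^sub>C g = (g * g) * (lam *\<^sub>C a + a^3)" "lam *\<^sub>C a + a^3 = (a * a) * (a + lam *\<^sub>C g)"
    by (simp_all add: distrib_left distrib_right scaleC_simps words power3_eq_cube add.commute)
  then show "right_ideal (a + lam *\<^sub>C b) = right_ideal (lam *\<^sub>C a + a^3) \<and>
    null_space (a + lam *\<^sub>C b) = null_space (lam *\<^sub>C a + a^3)"
    unfolding \<open>b = g\<close> by (metis right_ideal_subset_iff null_space_subsetI subset_antisym)
qed

end

end

section \<open>The statements that involve the weights\<close>

lemma all_equivalentI: "list_all (\<lambda>P. P \<longleftrightarrow> Q) Ps \<Longrightarrow> all_equivalent Ps"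
  by (auto simp: all_equivalent_def list_all_iff)

locale weighted_moore_penrose_group =
  fixes a b g e f :: "'a::complex_banach_algebra_1"
  assumes e: "e \<in> inv_elems" and f: "f \<in> inv_elems"
    and wmp_b: "is_wmp_inverse e f a b" and group_g: "is_group_inverse a g"
begin

sublocale group_and_generalized_inverse_banach a b g
  using wmp_b group_g unfolding is_wmp_inverse_def norm_gen_inverse_def is_group_inverse_def
  by unfold_locales metis+

abbreviation herm where "herm u \<equiv> hermitian_in (wnorm u) (a * g)"

text \<open>If \<open>a g\<close> is hermitian for both weights, then \<open>g\<close> is a weighted Moore-Penrose inverse, hence the only
  one. This condition is symmetric in the weights and can be tested one weight at a time, which settles all
  statements with other pairs of weights.\<close>

lemma hermitian_iff: "herm e \<and> herm f \<longleftrightarrow> b = g"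
  using is_wmp_inverse_unique[OF e f wmp_b] wmp_b is_wmp_inverse_group_inverse[OF group_g, of e f]
  by blast

lemma herm_wmp:
  assumes "u \<in> inv_elems" "v \<in> inv_elems" "herm u" "herm v"
  shows "wmp_invertible u v a" "wmp u v a = g"
  using assms wmp_eqI is_wmp_inverse_group_inverse[OF group_g, of u v]
  unfolding wmp_invertible_def by blast+

lemma hermitian_wmp:
  assumes "u \<in> inv_elems" "v \<in> inv_elems" "wmp_invertible u v a"
  shows "hermitian_in (wnorm u) (a * wmp u v a)" "hermitian_in (wnorm v) (wmp u v a * a)"
  using is_wmp_inverse_wmp[OF assms] unfolding is_wmp_inverse_def by blast+

lemma weighted_EP_iff: "weighted_EP e f a \<longleftrightarrow> b = g"
  using weighted_EP_iff_hermitian[OF e f group_g] hermitian_iff by blast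

lemma weighted_EP_inverse_iff: "weighted_EP f e b \<longleftrightarrow> b = g"
proof -
  have w: "is_wmp_inverse f e b a"
    using wmp_b unfolding is_wmp_inverse_def norm_gen_inverse_def by blast
  show ?thesis
    unfolding weighted_EP_def wmp_eqI[OF f e w] wmp_invertible_def using w commute_iff by metis
qed

lemma weighted_EP_swapped_iff: "weighted_EP f e a \<longleftrightarrow> b = g"
  using weighted_EP_iff_hermitian[OF f e group_g] hermitian_iff by blast

lemma weighted_EP_equal_weights_iff: "weighted_EP e e a \<and> weighted_EP f f a \<longleftrightarrow> b = g"
  using weighted_EP_iff_hermitian[OF e e group_g] weighted_EP_iff_hermitian[OF f f group_g]
    hermitian_iff by blast

lemma weighted_EP_power_iff:
  assumes k: "k \<ge> 1"
  shows "weighted_EP e f (a^k) \<longleftrightarrow> b = g"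
proof -
  have "is_group_inverse (a^k) (g^k)"
    by (simp add: is_group_inverse_def pow_words[OF k] mult.assoc)
  from weighted_EP_iff_hermitian[OF e f this] show ?thesis
    using hermitian_iff by (simp add: pow_words[OF k])
qed

lemma weighted_EP_group_inverse_iff: "weighted_EP e f g \<longleftrightarrow> b = g"
proof -
  have "is_group_inverse g a"
    using group_g unfolding is_group_inverse_def by metis
  from weighted_EP_iff_hermitian[OF e f this] show ?thesis
    using hermitian_iff by (simp add: word_simps)
qed

lemma projections_equal_weights_iff:
  "wmp_invertible e e a \<and> wmp_invertible f f a \<and>
    a * g = a * wmp e e a \<and> a * wmp e e a = a * wmp f f a \<longleftrightarrow> b = g"
  "wmp_invertible e e a \<and> wmp_invertible f f a \<and>
    a * g = wmp e e a * a \<and> wmp e e a * a = wmp f f a * a \<longleftrightarrow> b = g"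
proof -
  have "herm e \<and> herm f \<Longrightarrow> wmp_invertible e e a \<and> wmp_invertible f f a \<and> wmp e e a = g \<and> wmp f f a = g"
    using herm_wmp e f by blast
  moreover note hermitian_wmp[OF e e] hermitian_wmp[OF f f]
  ultimately show
    "wmp_invertible e e a \<and> wmp_invertible f f a \<and>
      a * g = a * wmp e e a \<and> a * wmp e e a = a * wmp f f a \<longleftrightarrow> b = g"
    "wmp_invertible e e a \<and> wmp_invertible f f a \<and>
      a * g = wmp e e a * a \<and> wmp e e a * a = wmp f f a * a \<longleftrightarrow> b = g"
    unfolding hermitian_iff[symmetric] using ag_commute by metis+
qed

lemma projections_swapped_weights_iff:
  "wmp_invertible f e a \<and> a * g = a * b \<and> a * b = a * wmp f e a \<longleftrightarrow> b = g"
  "wmp_invertible f e a \<and> a * g = wmp f e a * a \<and> wmp f e a * a = b * a \<longleftrightarrow> b = g"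
proof -
  have "b = g \<Longrightarrow> wmp_invertible f e a \<and> wmp f e a = g"
    using herm_wmp e f hermitian_iff by blast
  moreover have "hermitian_in (wnorm e) (a * b)" "hermitian_in (wnorm f) (b * a)"
    using wmp_b unfolding is_wmp_inverse_def by blast+
  moreover note hermitian_wmp[OF f e]
  ultimately show "wmp_invertible f e a \<and> a * g = a * b \<and> a * b = a * wmp f e a \<longleftrightarrow> b = g"
    "wmp_invertible f e a \<and> a * g = wmp f e a * a \<and> wmp f e a * a = b * a \<longleftrightarrow> b = g"
    using ag_commute hermitian_iff by metis+
qed

text \<open>The criterion for \<open>a + \<lambda> b\<close> applies to the inverses with weights \<open>(e, e)\<close> and with weights \<open>(f, f)\<close>
  in place of \<open>b\<close>.\<close>

lemma pencil_ideals_equal_weights_iff: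
  assumes lam: "lam \<noteq> 0"
  shows "wmp_invertible e e a \<and> wmp_invertible f f a \<and>
    right_ideal (a + lam *\<^sub>C wmp e e a) = right_ideal (a + lam *\<^sub>C wmp f f a) \<and>
    right_ideal (a + lam *\<^sub>C wmp f f a) = right_ideal (lam *\<^sub>C a + a^3) \<and>
    null_space (a + lam *\<^sub>C wmp e e a) = null_space (a + lam *\<^sub>C wmp f f a) \<and>
    null_space (a + lam *\<^sub>C wmp f f a) = null_space (lam *\<^sub>C a + a^3) \<longleftrightarrow> b = g"
    (is "?L \<longleftrightarrow> _")
proof
  assume L: ?L
  have "herm u" if u: "u \<in> inv_elems" "wmp_invertible u u a"
    and eq: "right_ideal (a + lam *\<^sub>C wmp u u a) = right_ideal (lam *\<^sub>C a + a^3)"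
      "null_space (a + lam *\<^sub>C wmp u u a) = null_space (lam *\<^sub>C a + a^3)" for u
  proof -
    interpret u: weighted_moore_penrose_group a "wmp u u a" g u u
      using u is_wmp_inverse_wmp group_g by unfold_locales
    show ?thesis using eq u.pencil_ideals_iff[OF lam] u.hermitian_iff by blast
  qed
  then show "b = g" unfolding hermitian_iff[symmetric] using L e f by simp
next
  assume bg: "b = g"
  then have "wmp_invertible e e a" "wmp_invertible f f a" "wmp e e a = g" "wmp f f a = g"
    using herm_wmp e f hermitian_iff by blast+
  then show ?L using bg pencil_ideals_iff[OF lam] by simp
qed

end

theorem theorem3p7:
  fixes a e f :: "'a::complex_banach_algebra_1"
    and k l :: nat
    and lam :: complex
  assumes "e \<in> inv_elems" "pos_elem e"
    and "f \<in> inv_elems" "pos_elem f"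
    and "wmp_invertible e f a"
    and "group_invertible a"
    and "k \<ge> 1" "l \<ge> 1"
    and "lam \<noteq> 0"
  shows "let b = wmp e f a; g = group_inverse a in
    all_equivalent
    [\<comment> \<open>i\<close> weighted_EP e f a,
     \<comment> \<open>ii\<close> right_ideal b = right_ideal a \<and> null_space b = null_space a,
     \<comment> \<open>iii\<close> right_ideal b \<subseteq> right_ideal a \<and> null_space a \<subseteq> null_space b,
     \<comment> \<open>iv\<close> right_ideal a \<subseteq> right_ideal b \<and> null_space a \<subseteq> null_space b,
     \<comment> \<open>v\<close> right_ideal b \<subseteq> right_ideal a \<and> null_space b \<subseteq> null_space a,
     \<comment> \<open>vi\<close> right_ideal a \<subseteq> right_ideal b \<and> null_space b \<subseteq> null_space a,
     \<comment> \<open>vii\<close> b = a * b^2 \<and> a * b^2 = b^2 * a,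
     \<comment> \<open>viii\<close> weighted_EP f e b,
     \<comment> \<open>ix\<close> b * g * a + a * g * b = 2 * b,
     \<comment> \<open>x\<close> b^2 * g = b * g * b \<and> b * g * b = g * b^2,
     \<comment> \<open>xi\<close> a * b^2 = g \<and> g = b^2 * a,
     \<comment> \<open>xii\<close> a * b * b * a = b * a * a * b,
     \<comment> \<open>xiii\<close> a * g * b = b * g * a,
     \<comment> \<open>xiv\<close> a \<in> (\<lambda>y. b * y) ` inv_elems \<inter> (\<lambda>y. y * b) ` inv_elems,
     \<comment> \<open>xv\<close> \<exists>u v. a = b * u \<and> a = v * b \<and> right_ideal u = UNIV \<and> null_space v = {0},
     \<comment> \<open>xvi\<close> a \<in> right_ideal b \<inter> left_ideal b,
     \<comment> \<open>xvii\<close> \<forall>c. a * c = c * a \<longrightarrow> b * c = c * b,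
     \<comment> \<open>xviii\<close> \<exists>U h. open U \<and> spectrum a \<subseteq> U \<and> h holomorphic_on U \<and> is_hol_calc U h a b,
     \<comment> \<open>xix\<close> g^k * b * a = b^k,
     \<comment> \<open>xx\<close> a^k = b * a * a^k \<and> b * a * a^k = a^k * a * b,
     \<comment> \<open>xxi\<close> b^k = g^k,
     \<comment> \<open>xxii\<close> g^k * b = b * g^k,
     \<comment> \<open>xxiii\<close> a^k * b = b * a^k,
     \<comment> \<open>xxiv\<close> a^(2 * k - 1) = b * a^(2 * k + 1) * b,
     \<comment> \<open>xxv\<close> a * b^(k + 1) = g^k \<and> g^k = b^(k + 1) * a,
     \<comment> \<open>xxvi\<close> a^k * a * b + b * a * a^k = 2 * a^k,
     \<comment> \<open>xxvii\<close> g^(k + l - 1) = b^l * g^(k - 1) \<and> b^l * g^(k - 1) = g^(k - 1) * b^l,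
     \<comment> \<open>xxviii\<close> a * b * g^(k + l - 1) = b^k * g^l * a \<and> b^k * g^l * a = g^l * a * b^k,
     \<comment> \<open>xxix\<close> weighted_EP f e a,
     \<comment> \<open>xxx\<close> weighted_EP e e a \<and> weighted_EP f f a,
     \<comment> \<open>xxxi\<close> weighted_EP e f (a^k),
     \<comment> \<open>xxxii\<close> weighted_EP e f g,
     \<comment> \<open>xxxiii\<close> wmp_invertible e e a \<and> wmp_invertible f f a \<and>
        a * g = a * wmp e e a \<and> a * wmp e e a = a * wmp f f a,
     \<comment> \<open>xxxiii, alternative\<close> wmp_invertible e e a \<and> wmp_invertible f f a \<and>
        a * g = wmp e e a * a \<and> wmp e e a * a = wmp f f a * a,
     \<comment> \<open>xxxiv\<close> wmp_invertible f e a \<and>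
        a * g = a * b \<and> a * b = a * wmp f e a,
     \<comment> \<open>xxxiv, alternative\<close> wmp_invertible f e a \<and>
        a * g = wmp f e a * a \<and> wmp f e a * a = b * a,
     \<comment> \<open>xxxv\<close> a * b * (a^k + lam *\<^sub>C b) = (a^k + lam *\<^sub>C b) * a * b,
     \<comment> \<open>xxxvi\<close> b * a * (a^k + lam *\<^sub>C b) = (a^k + lam *\<^sub>C b) * b * a,
     \<comment> \<open>xxxvii\<close> wmp_invertible e e a \<and> wmp_invertible f f a \<and>
        right_ideal (a + lam *\<^sub>C wmp e e a) = right_ideal (a + lam *\<^sub>C wmp f f a) \<and>
        right_ideal (a + lam *\<^sub>C wmp f f a) = right_ideal (lam *\<^sub>C a + a^3) \<and>
        null_space (a + lam *\<^sub>C wmp e e a) = null_space (a + lam *\<^sub>C wmp f f a) \<and>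
        null_space (a + lam *\<^sub>C wmp f f a) = null_space (lam *\<^sub>C a + a^3),
     \<comment> \<open>xxxviii\<close> right_ideal (a + lam *\<^sub>C b) = right_ideal (lam *\<^sub>C a + a^3) \<and>
        null_space (a + lam *\<^sub>C b) = null_space (lam *\<^sub>C a + a^3)]"
proof -
  define b where "b = wmp e f a"
  define g where "g = group_inverse a"
  have "is_group_inverse a g"
    using assms(6) group_inverse_eqI unfolding g_def group_invertible_def by metis
  then interpret weighted_moore_penrose_group a b g e f
    using assms is_wmp_inverse_wmp unfolding b_def by unfold_locales
  note k = \<open>k \<ge> 1\<close> and l = \<open>l \<ge> 1\<close> and lam = \<open>lam \<noteq> 0\<close>
  show ?thesis
    unfolding Let_def b_def[symmetric] g_def[symmetric]
    by (rule all_equivalentI[of "b = g"], simp only: list.pred_inject,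
        intro conjI TrueI weighted_EP_iff range_kernel_eq_iff range_kernel_inclusion_iff square_absorbed_iff weighted_EP_inverse_iff sum_projected_iff square_times_group_inverse_iff square_eq_group_inverse_iff projections_commute_iff
          commute_spectral_projection_iff unit_multiple_iff one_sided_unit_multiple_iff mem_ideals_iff bicommutant_iff hol_calc_iff power_eq_projected_iff[OF k] power_fixed_iff[OF k] power_eq_iff[OF k]
          commute_group_power_iff[OF k] commute_power_iff[OF k] odd_power_sandwich_iff[OF k] power_absorbed_iff[OF k] power_sum_projected_iff[OF k]
          mixed_powers_iff[OF k l] mixed_powers_projected_iff[OF k l] weighted_EP_swapped_iff weighted_EP_equal_weights_iff weighted_EP_power_iff[OF k] weighted_EP_group_inverse_iff
          projections_equal_weights_iff projections_swapped_weights_iff range_projection_pencil_iff[OF lam k] kernel_projection_pencil_iff[OF lam k] pencil_ideals_equal_weights_iff[OF lam]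
          pencil_ideals_iff[OF lam])
qed

end
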